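(* Let $r,\tilde r\ge1$, $D=3r+3\tilde r-2$, and let $\boldsymbol\xi$, $\boldsymbol\eta(\boldsymbol\xi)$ be as described in the context. For $\mathbf q'=(\mathbf m',\mathbf n',\mathbf p',\tilde{\mathbf m}',\tilde{\mathbf n}',\tilde{\mathbf p}')\in\mathbb Z^D$, $$\boldsymbol\eta^{\mathbf q'}=\boldsymbol\xi^{\mathbf q'}\Bigl(\sum_{i=-1}^{r-1}\sum_{\iota=-1}^{\tilde r-1}\boldsymbol\xi^{\mathfrak f_i+\tilde{\mathfrak f}_\iota}\,\Phi(\boldsymbol\xi;\boldsymbol\pi+\boldsymbol\nu^i,\tilde{\boldsymbol\pi}+\tilde{\boldsymbol\nu}^\iota)-\sum_{i=0}^{r-1}\sum_{\iota=0}^{\tilde r-1}\boldsymbol\xi^{\mathfrak g_i+\tilde{\mathfrak g}_\iota}\,\Phi(\boldsymbol\xi;\boldsymbol\pi+\boldsymbol\nu^i,\tilde{\boldsymbol\pi}+\tilde{\boldsymbol\nu}^\iota)\Bigr),$$ where $\boldsymbol\xi^{\mathfrak f_{-1}}=\boldsymbol\xi^{\mathfrak g_{-1}}=1$ and, for $0\le i\le r-1$, $\boldsymbol\xi^{\mathfrak f_i}=x_iz_0z_1\cdots z_{i-1}$, $\boldsymbol\xi^{\mathfrak g_i}=y_iz_0z_1\cdots z_{i-1}$; similarly $\boldsymbol\xi^{\tilde{\mathfrak f}_{-1}}=\boldsymbol\xi^{\tilde{\mathfrak g}_{-1}}=1$, $\boldsymbol\xi^{\tilde{\mathfrak f}_\iota}=\tilde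 x_\iota\tilde z_0\cdots\tilde z_{\iota-1}$, $\boldsymbol\xi^{\tilde{\mathfrak g}_\iota}=\tilde y_\iota\tilde z_0\cdots\tilde z_{\iota-1}$ for $0\le\iota\le\tilde r-1$; $\boldsymbol\pi\in\mathbb Z^r$ and $\boldsymbol\nu^i\in\mathbb Z^r$ are given by $\pi_j=p'_{j-1}+p'_j$, $\nu^i_j=2\sigma_{i,j-1}$ ($j=0,\dots,r-1$), and $\tilde{\boldsymbol\pi},\tilde{\boldsymbol\nu}^\iota\in\mathbb Z^{\tilde r}$ by $\tilde\pi_j=\tilde p'_{j-1}+\tilde p'_j$, $\tilde\nu^\iota_j=2\sigma_{\iota,j-1}$ ($j=0,\dots,\tilde r-1$), with $p'_{-1}=|\mathbf m'|+|\tilde{\mathbf n}'|$, $\tilde p'_{-1}=|\tilde{\mathbf m}'|+|\mathbf n'|$, $p'_{r-1}=\tilde p'_{\tilde r-1}=0$.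
   Context: Variables: $\mathbf x=(x_0,\dots,x_{r-1})$, $\mathbf y=(y_0,\dots,y_{r-1})$, $\mathbf z=(z_0,\dots,z_{r-2})$, $\tilde{\mathbf x}=(\tilde x_0,\dots,\tilde x_{\tilde r-1})$, $\tilde{\mathbf y}=(\tilde y_0,\dots,\tilde y_{\tilde r-1})$, $\tilde{\mathbf z}=(\tilde z_0,\dots,\tilde z_{\tilde r-2})$ form $\boldsymbol\xi$, $D$ independent formal indeterminates; $\boldsymbol\eta$ consists of $s_0,\dots,s_{r-1},t_0,\dots,t_{r-1},w_0,\dots,w_{r-2},\tilde s_0,\dots,\tilde s_{\tilde r-1},\tilde t_0,\dots,\tilde t_{\tilde r-1},\tilde w_0,\dots,\tilde w_{\tilde r-2}$, with conventions $w_{r-1}=\tilde w_{\tilde r-1}=0$. Define $f_i=\tilde g_j=\frac{1+w_0}{1+s_0+t_0}$, $\tilde f_j=g_i=\frac{1+\tilde w_0}{1+\tilde s_0+\tilde t_0}$ ($0\le i\le r-1$, $0\le j\le\tilde r-1$), $h_i=\frac{(1+w_i)(1+w_{i+1})}{(1+s_i+t_i)(1+s_{i+1}+t_{i+1})}$ ($0\le i\le r-2$), and $\tilde h_i$ analogously with tildes. Then $\boldsymbol\eta(\boldsymbol\xi)$ is the unique $D$-tuple of formal power series in $\boldsymbol\xi$ without constant terms satisfying $x_i=s_i/f_i$, $y_i=t_i/g_i$, $z_j=w_j/h_j$, $\tilde x_i=\tilde s_i/\tilde f_i$, $\tilde y_i=\tilde t_i/\tilde g_i$, $\tilde z_j=\tilde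 w_j/\tilde h_j$. Multi-indices $\mathbf q=(\mathbf m,\mathbf n,\mathbf p,\tilde{\mathbf m},\tilde{\mathbf n},\tilde{\mathbf p})\in\mathbb Z^D$ ($\mathbf m,\mathbf n\in\mathbb Z^r$, $\mathbf p\in\mathbb Z^{r-1}$, $\tilde{\mathbf m},\tilde{\mathbf n}\in\mathbb Z^{\tilde r}$, $\tilde{\mathbf p}\in\mathbb Z^{\tilde r-1}$), $\boldsymbol\xi^{\mathbf q}=\prod x_i^{m_i}y_i^{n_i}z_j^{p_j}\tilde x_i^{\tilde m_i}\tilde y_i^{\tilde n_i}\tilde z_j^{\tilde p_j}$, similarly $\boldsymbol\eta^{\mathbf q'}$; $|\mathbf m|=\sum_jm_j$. $\sigma_{ij}=0$ if $i\le j$ and $1$ if $i>j$. For integers $a,m,n,p$, $\binom{a}{m,n,p}=[x^my^nz^p](1+x+y+z)^a$ (equal to $a(a-1)\cdots(a-m-n-p+1)/(m!n!p!)$ if $m,n,p\ge0$ and $0$ otherwise). For $\boldsymbol\mu\in\mathbb Z^r$, $\tilde{\boldsymbol\mu}\in\mathbb Z^{\tilde r}$ define the formal power series $$\Phi(\boldsymbol\xi;\boldsymbol\mu,\tilde{\boldsymbol\mu})=\sum_{\mathbf q\ge0}(-1)^{|\mathbf m|+|\mathbf n|+|\tilde{\mathbf m}|+|\tilde{\mathbf n}|}\boldsymbol\xi^{\mathbf q}\prod_{j=0}^{r-1}\binom{\mu_j+m_j+n_j+p_{j-1}+p_j-1}{m_j,\ n_j,\ p_j}\prod_{j=0}^{\tilde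 r-1}\binom{\tilde\mu_j+\tilde m_j+\tilde n_j+\tilde p_{j-1}+\tilde p_j-1}{\tilde m_j,\ \tilde n_j,\ \tilde p_j},$$ with $p_{r-1}=\tilde p_{\tilde r-1}=0$, $p_{-1}=|\mathbf m|+|\tilde{\mathbf n}|$, $\tilde p_{-1}=|\tilde{\mathbf m}|+|\mathbf n|$. *)

theory Defs
  imports "HOL-Library.Poly_Mapping" "HOL-Library.Countable"
    "HOL-Computational_Algebra.Computational_Algebra"
begin

section \<open>Multivariate formal power series\<close>

typedef ('v, 'a) mps = "UNIV :: (('v \<Rightarrow>\<^sub>0 nat) \<Rightarrow> 'a) set"
  morphisms mcoeff Abs_mps
  by simp

setup_lifting type_definition_mps

lemma mps_eqI: "(\<And>q. mcoeff f q = mcoeff g q) \<Longrightarrow> f = g"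
  by transfer auto

lemma mcoeff_Abs [simp]: "mcoeff (Abs_mps c) = c"
  by (simp add: Abs_mps_inverse)

definition splits :: "('v \<Rightarrow>\<^sub>0 nat) \<Rightarrow> (('v \<Rightarrow>\<^sub>0 nat) \<times> ('v \<Rightarrow>\<^sub>0 nat)) set" where
  "splits q = {(a, b). a + b = q}"

lemma finite_bounded_monomials:
  assumes "finite V"
  shows "finite {a :: 'v \<Rightarrow>\<^sub>0 nat. Poly_Mapping.keys a \<subseteq> V \<and> (\<forall>v. Poly_Mapping.lookup a v \<le> N)}"
proof -
  let ?F = "{f :: 'v \<Rightarrow> nat. \<forall>x. (x \<in> V \<longrightarrow> f x \<in> {..N}) \<and> (x \<notin> V \<longrightarrow> f x = 0)}"
  have "finite ?F"
    using assms by (rule finite_set_of_finite_funs) simp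
  moreover have "Poly_Mapping.lookup ` {a. Poly_Mapping.keys a \<subseteq> V \<and> (\<forall>v. Poly_Mapping.lookup a v \<le> N)} \<subseteq> ?F"
    by (auto simp: in_keys_iff)
  ultimately show ?thesis
    by (meson finite_imageD finite_subset inj_onI lookup_inject)
qed

lemma finite_splits [simp]: "finite (splits (q :: 'v \<Rightarrow>\<^sub>0 nat))"
proof -
  define N where "N = Max (insert 0 (Poly_Mapping.lookup q ` Poly_Mapping.keys q))"
  let ?S = "{a :: 'v \<Rightarrow>\<^sub>0 nat. Poly_Mapping.keys a \<subseteq> Poly_Mapping.keys q \<and> (\<forall>v. Poly_Mapping.lookup a v \<le> N)}"
  have N: "Poly_Mapping.lookup q v \<le> N" for v
    unfolding N_def by (cases "v \<in> Poly_Mapping.keys q") (auto intro!: Max_ge simp: in_keys_iff)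
  have S: "a \<in> ?S" if "\<And>v. Poly_Mapping.lookup a v \<le> Poly_Mapping.lookup q v" for a
  proof -
    have "Poly_Mapping.keys a \<subseteq> Poly_Mapping.keys q"
      using that by (metis in_keys_iff le_zero_eq subsetI)
    moreover have "Poly_Mapping.lookup a v \<le> N" for v
      using that N order_trans by blast
    ultimately show ?thesis by simp
  qed
  have "splits q \<subseteq> ?S \<times> ?S"
  proof
    fix ab assume "ab \<in> splits q"
    then obtain a b where ab: "ab = (a, b)" "a + b = q" by (auto simp: splits_def)
    have "a \<in> ?S" "b \<in> ?S"
      by (rule S; simp add: ab(2) [symmetric] lookup_add)+
    with ab(1) show "ab \<in> ?S \<times> ?S" by blast
  qed
  thus ?thesis
    using finite_bounded_monomials[OF finite_keys[of q], of N] by (meson finite_SigmaI finite_subset)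
qed

instantiation mps :: (type, comm_ring_1) comm_ring_1
begin

lift_definition zero_mps :: "('a, 'b) mps" is "\<lambda>_. 0" .
lift_definition one_mps :: "('a, 'b) mps" is "\<lambda>q. if q = 0 then 1 else 0" .
lift_definition plus_mps :: "('a, 'b) mps \<Rightarrow> ('a, 'b) mps \<Rightarrow> ('a, 'b) mps" is "\<lambda>f g q. f q + g q" .
lift_definition minus_mps :: "('a, 'b) mps \<Rightarrow> ('a, 'b) mps \<Rightarrow> ('a, 'b) mps" is "\<lambda>f g q. f q - g q" .
lift_definition uminus_mps :: "('a, 'b) mps \<Rightarrow> ('a, 'b) mps" is "\<lambda>f q. - f q" .
lift_definition times_mps :: "('a, 'b) mps \<Rightarrow> ('a, 'b) mps \<Rightarrow> ('a, 'b) mps"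
  is "\<lambda>f g q. \<Sum>(a, b)\<in>splits q. f a * g b" .

instance
proof
  fix f g h :: "('a, 'b) mps"
  show "f * g * h = f * (g * h)"
  proof (transfer, rule ext)
    fix f g h :: "('a \<Rightarrow>\<^sub>0 nat) \<Rightarrow> 'b" and q
    have "(\<Sum>(a, c)\<in>splits q. (\<Sum>(a, b)\<in>splits a. f a * g b) * h c)
      = (\<Sum>((a, c), (a', b))\<in>(SIGMA p:splits q. splits (fst p)). f a' * g b * h c)"
      by (subst sum.Sigma [symmetric]) (auto simp: sum_distrib_right case_prod_unfold intro!: sum.cong)
    also have "\<dots> = (\<Sum>((a, c), (b, c'))\<in>(SIGMA p:splits q. splits (snd p)). f a * (g b * h c'))"
      by (rule sum.reindex_bij_witness[where
            i = "\<lambda>((a, c), (b, c')). ((a + b, c'), (a, b))" and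
            j = "\<lambda>((a, c), (a', b)). ((a', b + c), (b, c))"])
         (auto simp: splits_def ac_simps)
    also have "\<dots> = (\<Sum>(a, c)\<in>splits q. f a * (\<Sum>(b, c)\<in>splits c. g b * h c))"
      by (subst sum.Sigma [symmetric]) (auto simp: sum_distrib_left case_prod_unfold intro!: sum.cong)
    finally show "(\<Sum>(a, c)\<in>splits q. (\<Sum>(a, b)\<in>splits a. f a * g b) * h c)
      = (\<Sum>(a, c)\<in>splits q. f a * (\<Sum>(b, c)\<in>splits c. g b * h c))" .
  qed
  show "f * g = g * f"
  proof (transfer, rule ext)
    fix f g :: "('a \<Rightarrow>\<^sub>0 nat) \<Rightarrow> 'b" and q
    show "(\<Sum>(a, b)\<in>splits q. f a * g b) = (\<Sum>(a, b)\<in>splits q. g a * f b)"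
      by (rule sum.reindex_bij_witness[where i = prod.swap and j = prod.swap])
         (auto simp: splits_def ac_simps)
  qed
  show "1 * f = f"
  proof (transfer, rule ext)
    fix f :: "('a \<Rightarrow>\<^sub>0 nat) \<Rightarrow> 'b" and q
    have "(\<Sum>(a, b)\<in>splits q. (if a = 0 then 1 else 0) * f b) = (\<Sum>(a, b)\<in>{(0 :: 'a \<Rightarrow>\<^sub>0 nat, q)}. (if a = 0 then 1 else 0) * f b)"
      by (rule sum.mono_neutral_right, simp, auto simp: splits_def split: if_splits)
    thus "(\<Sum>(a, b)\<in>splits q. (if a = 0 then 1 else 0) * f b) = f q" by simp
  qed
  show "(f + g) * h = f * h + g * h"
    by transfer (auto simp: fun_eq_iff sum.distrib [symmetric] algebra_simps intro!: sum.cong)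
  show "(0 :: ('a, 'b) mps) \<noteq> 1"
    by transfer (auto simp: fun_eq_iff)
qed (transfer; simp add: fun_eq_iff algebra_simps; fail)+

end

lemma mcoeff_simps [simp]:
  "mcoeff 0 q = 0"
  "mcoeff 1 q = (if q = 0 then 1 else 0)"
  "mcoeff (f + g) q = mcoeff f q + mcoeff g q"
  "mcoeff (f - g) q = mcoeff f q - mcoeff g q"
  "mcoeff (- f) q = - mcoeff f q"
  by (transfer; simp)+

lemma mcoeff_mult: "mcoeff (f * g) q = (\<Sum>(a, b)\<in>splits q. mcoeff f a * mcoeff g b)"
  by transfer simp

definition mdeg :: "('v \<Rightarrow>\<^sub>0 nat) \<Rightarrow> nat" where
  "mdeg q = (\<Sum>v\<in>Poly_Mapping.keys q. Poly_Mapping.lookup q v)"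

lemma mdeg_superset: "finite V \<Longrightarrow> Poly_Mapping.keys q \<subseteq> V \<Longrightarrow> mdeg q = (\<Sum>v\<in>V. Poly_Mapping.lookup q v)"
  unfolding mdeg_def by (rule sum.mono_neutral_left) (auto simp: in_keys_iff)

lemma keys_add_nat: "Poly_Mapping.keys (a + b :: 'v \<Rightarrow>\<^sub>0 nat) = Poly_Mapping.keys a \<union> Poly_Mapping.keys b"
  by (auto simp: in_keys_iff lookup_add)

lemma mdeg_add: "mdeg (a + b) = mdeg a + mdeg b"
  using mdeg_superset[of "Poly_Mapping.keys a \<union> Poly_Mapping.keys b" a] mdeg_superset[of "Poly_Mapping.keys a \<union> Poly_Mapping.keys b" b]
    mdeg_superset[of "Poly_Mapping.keys a \<union> Poly_Mapping.keys b" "a + b"]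
  by (simp add: keys_add_nat lookup_add sum.distrib)

text \<open>The order on the indeterminates only serves to single out a lowest term of a series.\<close>

lemma lowest_term:
  fixes f :: "('v :: linorder, 'a :: comm_ring_1) mps"
  assumes "finite V" "mcoeff f p \<noteq> 0" "Poly_Mapping.keys p \<subseteq> V"
  obtains a where "mcoeff f a \<noteq> 0" "Poly_Mapping.keys a \<subseteq> V"
    "\<forall>b. mcoeff f b \<noteq> 0 \<and> Poly_Mapping.keys b \<subseteq> V \<longrightarrow> mdeg a < mdeg b \<or> (mdeg a = mdeg b \<and> a \<le> b)"
proof -
  define A where "A = {q. mcoeff f q \<noteq> 0 \<and> Poly_Mapping.keys q \<subseteq> V}"
  define d where "d = (LEAST n. n \<in> mdeg ` A)"
  define B where "B = {q \<in> A. mdeg q = d}"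
  have "p \<in> A" using assms by (simp add: A_def)
  hence "d \<in> mdeg ` A" unfolding d_def by (metis (mono_tags, lifting) LeastI image_eqI)
  hence ne: "B \<noteq> {}" by (auto simp: B_def)
  have le: "d \<le> mdeg q" if "q \<in> A" for q
    unfolding d_def using that by (rule Least_le[OF imageI])
  have "B \<subseteq> {a. Poly_Mapping.keys a \<subseteq> V \<and> (\<forall>v. Poly_Mapping.lookup a v \<le> d)}"
  proof
    fix q assume "q \<in> B"
    hence q: "Poly_Mapping.keys q \<subseteq> V" "mdeg q = d" by (auto simp: B_def A_def)
    have "Poly_Mapping.lookup q v \<le> mdeg q" for v
    proof (cases "v \<in> Poly_Mapping.keys q")
      case True
      thus ?thesis unfolding mdeg_def by (intro member_le_sum) auto
    qed (simp add: in_keys_iff)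
    with q show "q \<in> {a. Poly_Mapping.keys a \<subseteq> V \<and> (\<forall>v. Poly_Mapping.lookup a v \<le> d)}" by auto
  qed
  hence fin: "finite B"
    using finite_bounded_monomials[OF assms(1)] finite_subset by blast
  have M: "Min B \<in> B" using fin ne by (rule Min_in)
  show ?thesis
  proof (rule that[of "Min B"])
    show "mcoeff f (Min B) \<noteq> 0" "Poly_Mapping.keys (Min B) \<subseteq> V" using M by (auto simp: B_def A_def)
    have "mdeg (Min B) < mdeg b \<or> (mdeg (Min B) = mdeg b \<and> Min B \<le> b)"
      if "mcoeff f b \<noteq> 0" "Poly_Mapping.keys b \<subseteq> V" for b
    proof -
      from that have b: "b \<in> A" by (simp add: A_def)
      have "mdeg (Min B) = d" using M by (simp add: B_def)
      moreover have "Min B \<le> b" if "mdeg b = d"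
        using that b fin by (intro Min_le) (auto simp: B_def)
      ultimately show ?thesis using le[OF b] by linarith
    qed
    thus "\<forall>b. mcoeff f b \<noteq> 0 \<and> Poly_Mapping.keys b \<subseteq> V \<longrightarrow>
        mdeg (Min B) < mdeg b \<or> (mdeg (Min B) = mdeg b \<and> Min B \<le> b)" by blast
  qed
qed

instance mps :: (linorder, idom) idom
proof
  fix f g :: "('a, 'b) mps"
  assume "f \<noteq> 0" "g \<noteq> 0"
  then obtain p p' where p: "mcoeff f p \<noteq> 0" "mcoeff g p' \<noteq> 0"
    using mps_eqI[of f 0] mps_eqI[of g 0] by auto
  define V where "V = Poly_Mapping.keys p \<union> Poly_Mapping.keys p'"
  have V: "finite V" "Poly_Mapping.keys p \<subseteq> V" "Poly_Mapping.keys p' \<subseteq> V" by (auto simp: V_def)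
  obtain a where a: "mcoeff f a \<noteq> 0" "Poly_Mapping.keys a \<subseteq> V"
    "\<forall>b. mcoeff f b \<noteq> 0 \<and> Poly_Mapping.keys b \<subseteq> V \<longrightarrow> mdeg a < mdeg b \<or> (mdeg a = mdeg b \<and> a \<le> b)"
    by (rule lowest_term[OF V(1) p(1) V(2)]) (rule that)
  obtain b where b: "mcoeff g b \<noteq> 0" "Poly_Mapping.keys b \<subseteq> V"
    "\<forall>c. mcoeff g c \<noteq> 0 \<and> Poly_Mapping.keys c \<subseteq> V \<longrightarrow> mdeg b < mdeg c \<or> (mdeg b = mdeg c \<and> b \<le> c)"
    by (rule lowest_term[OF V(1) p(2) V(3)]) (rule that)
  have "mcoeff (f * g) (a + b) = (\<Sum>(c, d)\<in>{(a, b)}. mcoeff f c * mcoeff g d)"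
    unfolding mcoeff_mult
  proof (rule sum.mono_neutral_right)
    show "\<forall>i\<in>splits (a + b) - {(a, b)}. (case i of (c, d) \<Rightarrow> mcoeff f c * mcoeff g d) = 0"
    proof
      fix i assume "i \<in> splits (a + b) - {(a, b)}"
      then obtain c d where i: "i = (c, d)" and cd': "c + d = a + b" "c = a \<longrightarrow> d \<noteq> b"
        by (cases i) (auto simp: splits_def)
      show "(case i of (c, d) \<Rightarrow> mcoeff f c * mcoeff g d) = 0"
      proof (rule ccontr)
        assume "(case i of (c, d) \<Rightarrow> mcoeff f c * mcoeff g d) \<noteq> 0"
        hence c: "mcoeff f c \<noteq> 0" and cd: "c + d = a + b" "c = a \<longrightarrow> d \<noteq> b" "mcoeff g d \<noteq> 0"
          using i cd' by auto
        have "Poly_Mapping.keys c \<union> Poly_Mapping.keys d \<subseteq> V"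
          using a(2) b(2) cd(1) keys_add_nat[of c d] keys_add_nat[of a b] by auto
        hence k: "Poly_Mapping.keys c \<subseteq> V" "Poly_Mapping.keys d \<subseteq> V" by auto
        have "mdeg c + mdeg d = mdeg a + mdeg b"
          using cd(1) by (metis mdeg_add)
        with a(3)[rule_format, OF conjI[OF c k(1)]] b(3)[rule_format, OF conjI[OF cd(3) k(2)]]
        have le: "a \<le> c" "b \<le> d" by auto
        have "a = c"
        proof (rule ccontr)
          assume "a \<noteq> c"
          hence "a + b < c + b" using le by (simp add: less_le)
          also have "\<dots> \<le> c + d" using le by simp
          finally show False using cd(1) by simp
        qed
        with cd show False by auto
      qed
    qed
  qed (simp, simp add: splits_def)
  hence "mcoeff (f * g) (a + b) \<noteq> 0" using a(1) b(1) by simp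
  thus "f * g \<noteq> 0" by auto
qed

definition indet :: "'v \<Rightarrow> ('v, 'a :: comm_ring_1) mps" where
  "indet v = Abs_mps (\<lambda>q. if q = Poly_Mapping.single v 1 then 1 else 0)"

definition series_in :: "'v set \<Rightarrow> ('v, 'a :: comm_ring_1) mps set" where
  "series_in V = {f. \<forall>q. mcoeff f q \<noteq> 0 \<longrightarrow> Poly_Mapping.keys q \<subseteq> V}"


section \<open>Labels for indeterminates\<close>

text \<open>The suffix \<open>t\<close> stands for a tilde. The same labels index the tuples
  \<open>\<xi> = (x, y, z, xt, yt, zt)\<close> and \<open>\<eta> = (s, t, w, st, tt, wt)\<close> and the multi-indices
  \<open>q = (m, n, p, mt, nt, pt)\<close>; only labels in \<open>vars r rt\<close> are relevant.\<close>

datatype var = X nat | Y nat | Z nat | Xt nat | Yt nat | Zt nat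

instance var :: countable
  by countable_datatype

text \<open>An arbitrary linear order, needed only to obtain the \<open>idom\<close> instance of
  power series, and hence its field of fractions.\<close>

instantiation var :: linorder
begin

definition less_eq_var :: "var \<Rightarrow> var \<Rightarrow> bool" where
  "(u :: var) \<le> v \<longleftrightarrow> to_nat u \<le> to_nat v"

definition less_var :: "var \<Rightarrow> var \<Rightarrow> bool" where
  "(u :: var) < v \<longleftrightarrow> to_nat u < to_nat v"

instance
  by standard (auto simp: less_eq_var_def less_var_def)

end

definition vars :: "nat \<Rightarrow> nat \<Rightarrow> var set" where
  "vars r rt = X ` {..<r} \<union> Y ` {..<r} \<union> Z ` {..<r - 1}
             \<union> Xt ` {..<rt} \<union> Yt ` {..<rt} \<union> Zt ` {..<rt - 1}"


section \<open>The tuple \<open>\<eta>(\<xi>)\<close>\<close>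

definition w_ext :: "nat \<Rightarrow> (var \<Rightarrow> 'b :: zero) \<Rightarrow> nat \<Rightarrow> 'b" where
  "w_ext r e i = (if i = r - 1 then 0 else e (Z i))"

definition wt_ext :: "nat \<Rightarrow> (var \<Rightarrow> 'b :: zero) \<Rightarrow> nat \<Rightarrow> 'b" where
  "wt_ext rt e i = (if i = rt - 1 then 0 else e (Zt i))"

text \<open>\<open>eta_factor r rt e\<close> at \<open>X i\<close>, \<open>Y i\<close>, \<open>Z i\<close>, \<open>Xt i\<close>, \<open>Yt i\<close>, \<open>Zt i\<close> is respectively
  \<open>f\<^sub>i\<close>, \<open>g\<^sub>i\<close>, \<open>h\<^sub>i\<close>, \<open>ft\<^sub>i\<close>, \<open>gt\<^sub>i\<close>, \<open>ht\<^sub>i\<close>, evaluated at \<open>e\<close>.\<close>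

fun eta_factor :: "nat \<Rightarrow> nat \<Rightarrow> (var \<Rightarrow> 'b :: field) \<Rightarrow> var \<Rightarrow> 'b" where
  "eta_factor r rt e (X i) = (1 + w_ext r e 0) / (1 + e (X 0) + e (Y 0))"
| "eta_factor r rt e (Y i) = (1 + wt_ext rt e 0) / (1 + e (Xt 0) + e (Yt 0))"
| "eta_factor r rt e (Z i) = ((1 + w_ext r e i) * (1 + w_ext r e (i + 1)))
     / ((1 + e (X i) + e (Y i)) * (1 + e (X (i + 1)) + e (Y (i + 1))))"
| "eta_factor r rt e (Xt i) = (1 + wt_ext rt e 0) / (1 + e (Xt 0) + e (Yt 0))"
| "eta_factor r rt e (Yt i) = (1 + w_ext r e 0) / (1 + e (X 0) + e (Y 0))"
| "eta_factor r rt e (Zt i) = ((1 + wt_ext rt e i) * (1 + wt_ext rt e (i + 1)))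
     / ((1 + e (Xt i) + e (Yt i)) * (1 + e (Xt (i + 1)) + e (Yt (i + 1))))"

text \<open>The equations \<open>x\<^sub>i = s\<^sub>i / f\<^sub>i\<close> etc. are read in the field of fractions of the power series
  ring. There the denominators are nonzero: the series \<open>eta v\<close> have no constant term.\<close>

definition is_eta :: "nat \<Rightarrow> nat \<Rightarrow> (var \<Rightarrow> (var, 'a :: field_char_0) mps) \<Rightarrow> bool" where
  "is_eta r rt eta \<longleftrightarrow>
     (\<forall>v\<in>vars r rt. eta v \<in> series_in (vars r rt) \<and> mcoeff (eta v) 0 = 0) \<and>
     (\<forall>v\<in>vars r rt. to_fract (indet v)
        = to_fract (eta v) / eta_factor r rt (\<lambda>u. to_fract (eta u)) v)"

definition fract_monomial :: "nat \<Rightarrow> nat \<Rightarrow> (var \<Rightarrow> (var, 'a :: field_char_0) mps)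
    \<Rightarrow> (var \<Rightarrow> int) \<Rightarrow> (var, 'a) mps fract" where
  "fract_monomial r rt e q = (\<Prod>v\<in>vars r rt. to_fract (e v) powi q v)"


section \<open>The series \<open>\<Phi>\<close>\<close>

definition trinom :: "int \<Rightarrow> int \<Rightarrow> int \<Rightarrow> int \<Rightarrow> 'a :: field_char_0" where
  "trinom a m n p =
     (if m \<ge> 0 \<and> n \<ge> 0 \<and> p \<ge> 0
      then (\<Prod>i<nat (m + n + p). of_int a - of_nat i) / (fact (nat m) * fact (nat n) * fact (nat p))
      else 0)"

lemma trinom_lower:
  fixes a :: int and k m n p :: nat
  assumes "m + n + p = Suc k"
  defines "P \<equiv> (\<Prod>i<k. of_int a - of_nat i) / (fact m * fact n * fact p) :: 'a :: field_char_0"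
  shows "trinom a (int m - 1) (int n) (int p) = of_nat m * P"
    and "trinom a (int m) (int n - 1) (int p) = of_nat n * P"
    and "trinom a (int m) (int n) (int p - 1) = of_nat p * P"
    and "trinom a (int m) (int n) (int p) = (of_int a - of_nat k) * P"
    and "trinom (a + 1) (int m) (int n) (int p) = (of_int a + 1) * P"
proof -
  show "trinom a (int m - 1) (int n) (int p) = of_nat m * P"
  proof (cases m)
    case (Suc m')
    hence eq: "int m - 1 = int m'" by simp
    hence "nat (int m' + int n + int p) = k" using assms(1) by simp
    thus ?thesis unfolding eq by (simp add: trinom_def P_def Suc field_simps del: of_nat_Suc)
  qed (simp add: trinom_def)
  show "trinom a (int m) (int n - 1) (int p) = of_nat n * P"
  proof (cases n)
    case (Suc n')
    hence eq: "int n - 1 = int n'" by simp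
    hence "nat (int m + int n' + int p) = k" using assms(1) by simp
    thus ?thesis unfolding eq by (simp add: trinom_def P_def Suc field_simps del: of_nat_Suc)
  qed (simp add: trinom_def)
  show "trinom a (int m) (int n) (int p - 1) = of_nat p * P"
  proof (cases p)
    case (Suc p')
    hence eq: "int p - 1 = int p'" by simp
    hence "nat (int m + int n + int p') = k" using assms(1) by simp
    thus ?thesis unfolding eq by (simp add: trinom_def P_def Suc field_simps del: of_nat_Suc)
  qed (simp add: trinom_def)
  have k: "nat (int m + int n + int p) = Suc k" using assms(1) by simp
  show "trinom a (int m) (int n) (int p) = (of_int a - of_nat k) * P"
    by (simp add: trinom_def P_def k)
  have "(\<Prod>i<k. of_int (a + 1) - of_nat (Suc i)) = (\<Prod>i<k. of_int a - of_nat i :: 'a)"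
    by simp
  thus "trinom (a + 1) (int m) (int n) (int p) = (of_int a + 1) * P"
    by (simp add: trinom_def P_def k prod.lessThan_Suc_shift del: prod.lessThan_Suc)
qed

lemma trinom_step:
  "trinom (a + 1) (int m) (int n) (int p) =
     (trinom a (int m) (int n) (int p) + trinom a (int m - 1) (int n) (int p)
      + trinom a (int m) (int n - 1) (int p) + trinom a (int m) (int n) (int p - 1)
        :: 'a :: field_char_0)"
proof (cases "m + n + p")
  case 0
  thus ?thesis by (simp add: trinom_def)
next
  case (Suc k)
  hence k: "(of_nat k :: 'a) = of_nat m + of_nat n + of_nat p - 1"
    by (metis add_diff_cancel_left' of_nat_Suc of_nat_add)
  show ?thesis
    unfolding trinom_lower(1-4)[OF Suc, of a] trinom_lower(5)[OF Suc, of a] k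
    by (simp only: algebra_simps)
qed

lemma mcoeff_indet_mult:
  "mcoeff (indet v * f) q =
     (if Poly_Mapping.lookup q v = 0 then 0 else mcoeff f (q - Poly_Mapping.single v 1))"
proof (cases "Poly_Mapping.lookup q v = 0")
  case True
  have "a \<noteq> Poly_Mapping.single v 1" if "(a, b) \<in> splits q" for a b
    using that True by (auto simp: splits_def lookup_add)
  hence "mcoeff (indet v * f) q = 0"
    unfolding mcoeff_mult by (intro sum.neutral) (auto simp: indet_def)
  thus ?thesis using True by simp
next
  case False
  have q: "Poly_Mapping.single v 1 + (q - Poly_Mapping.single v 1) = q"
    using False by (intro poly_mapping_eqI) (auto simp: lookup_add lookup_minus lookup_single when_def)
  have "mcoeff (indet v * f) q =
      (\<Sum>(a, b)\<in>{(Poly_Mapping.single v 1, q - Poly_Mapping.single v 1)}. mcoeff (indet v) a * mcoeff f b)"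
    unfolding mcoeff_mult
  proof (rule sum.mono_neutral_right)
    show "{(Poly_Mapping.single v 1, q - Poly_Mapping.single v 1)} \<subseteq> splits q"
      using q by (simp add: splits_def)
    show "\<forall>i\<in>splits q - {(Poly_Mapping.single v 1, q - Poly_Mapping.single v 1)}.
        (case i of (a, b) \<Rightarrow> mcoeff (indet v) a * mcoeff f b) = 0"
      by (auto simp: splits_def indet_def split: if_splits)
  qed simp
  thus ?thesis using False by (simp add: indet_def)
qed

text \<open>The closed form of \<open>trinom\<close> does give the coefficients of \<open>(1 + x + y + z)\<^sup>a\<close>, also for
  negative \<open>a\<close>.\<close>

lemma trinom_generating:
  fixes u v w :: "'v :: linorder"
  assumes uvw: "u \<noteq> v" "u \<noteq> w" "v \<noteq> w"
  shows "to_fract (Abs_mps (\<lambda>q. if Poly_Mapping.keys q \<subseteq> {u, v, w}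
           then trinom a (int (Poly_Mapping.lookup q u)) (int (Poly_Mapping.lookup q v))
                  (int (Poly_Mapping.lookup q w)) else 0) :: ('v, 'a :: field_char_0) mps)
         = to_fract (1 + indet u + indet v + indet w) powi a"
    (is "to_fract (?G a) = to_fract ?L powi a")
proof -
  have keys_minus: "Poly_Mapping.keys (q - Poly_Mapping.single t 1) \<subseteq> {u, v, w}
      \<longleftrightarrow> Poly_Mapping.keys q \<subseteq> {u, v, w}"
    if "t \<in> {u, v, w}" for t and q :: "'v \<Rightarrow>\<^sub>0 nat"
  proof -
    have "s \<in> Poly_Mapping.keys (q - Poly_Mapping.single t 1) \<longleftrightarrow> s \<in> Poly_Mapping.keys q"
      if "s \<notin> {u, v, w}" for s
      using that \<open>t \<in> {u, v, w}\<close> by (auto simp: in_keys_iff lookup_minus lookup_single when_def)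
    thus ?thesis by blast
  qed
  have step: "?G (a + 1) = ?L * ?G a" for a
  proof (rule mps_eqI)
    fix q
    have neg: "trinom a (- 1) n p = (0 :: 'a)" "trinom a m (- 1) p = (0 :: 'a)"
      "trinom a m n (- 1) = (0 :: 'a)" for m n p
      by (simp_all add: trinom_def)
    have dec: "int (k - Suc 0) = int k - 1" if "0 < k" for k :: nat
      using that by simp
    show "mcoeff (?G (a + 1)) q = mcoeff (?L * ?G a) q"
    proof (cases "Poly_Mapping.keys q \<subseteq> {u, v, w}")
      case True
      thus ?thesis
        using uvw uvw[symmetric]
        by (simp add: ring_distribs mcoeff_indet_mult keys_minus[unfolded One_nat_def] trinom_step lookup_minus
            lookup_single neg dec)
    next
      case False
      thus ?thesis
        by (simp add: ring_distribs mcoeff_indet_mult keys_minus[unfolded One_nat_def])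
    qed
  qed
  have zero: "?G 0 = 1"
  proof (rule mps_eqI)
    fix q :: "'v \<Rightarrow>\<^sub>0 nat"
    have "trinom 0 (int m) (int n) (int p) = (if m = 0 \<and> n = 0 \<and> p = 0 then 1 else 0 :: 'a)" for m n p
    proof (cases "m + n + p")
      case (Suc k)
      have "trinom 0 (int m) (int n) (int p) = (0 :: 'a)"
        using Suc trinom_lower(4)[OF Suc, of 0, where 'a = 'a]
        by (cases k) (simp_all add: prod.lessThan_Suc_shift del: prod.lessThan_Suc)
      with Suc show ?thesis by auto
    qed (simp add: trinom_def)
    moreover have "trinom 0 0 0 0 = (1 :: 'a)" by (simp add: trinom_def)
    moreover have "q = 0" if "Poly_Mapping.keys q \<subseteq> {u, v, w}" "Poly_Mapping.lookup q u = 0"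
        "Poly_Mapping.lookup q v = 0" "Poly_Mapping.lookup q w = 0"
      using that by (metis ex_in_conv in_keys_iff insertE keys_eq_empty subsetD)
    ultimately show "mcoeff (?G 0) q = mcoeff 1 q" by auto
  qed
  have "Poly_Mapping.single t (Suc 0) \<noteq> 0" for t :: 'v
    by (metis lookup_single_eq lookup_zero nat.simps(3))
  hence "mcoeff ?L 0 = 1"
    by (simp add: indet_def eq_commute[of 0])
  hence L: "to_fract ?L \<noteq> 0"
    by (metis mcoeff_simps(1) to_fract_0 to_fract_eq_iff zero_neq_one)
  show ?thesis
  proof (induction a rule: int_induct[where k = 0])
    case base
    show ?case by (simp only: zero to_fract_1 power_int_0_right)
  next
    case (step1 a)
    show ?case by (simp only: step to_fract_mult step1(2) power_int_add_1'[OF disjI1[OF L]])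
  next
    case (step2 a)
    have G: "to_fract (?G a) = to_fract ?L * to_fract (?G (a - 1))"
      using step[of "a - 1"] by (simp only: to_fract_mult diff_add_cancel)
    have P: "to_fract ?L powi a = to_fract ?L * to_fract ?L powi (a - 1)"
      using power_int_add_1'[OF disjI1[OF L], of "a - 1"] by (simp only: diff_add_cancel)
    show ?case
      by (rule mult_left_cancel[OF L, THEN iffD1]) (simp only: G[symmetric] P[symmetric] step2(2))
  qed
qed

definition p_ext :: "nat \<Rightarrow> nat \<Rightarrow> (var \<Rightarrow> int) \<Rightarrow> int \<Rightarrow> int" where
  "p_ext r rt q j =
     (if j = -1 then (\<Sum>i<r. q (X i)) + (\<Sum>i<rt. q (Yt i))
      else if j = int r - 1 then 0
      else q (Z (nat j)))"

definition pt_ext :: "nat \<Rightarrow> nat \<Rightarrow> (var \<Rightarrow> int) \<Rightarrow> int \<Rightarrow> int" where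
  "pt_ext r rt q j =
     (if j = -1 then (\<Sum>i<rt. q (Xt i)) + (\<Sum>i<r. q (Y i))
      else if j = int rt - 1 then 0
      else q (Zt (nat j)))"

definition Phi_coeff :: "nat \<Rightarrow> nat \<Rightarrow> (nat \<Rightarrow> int) \<Rightarrow> (nat \<Rightarrow> int) \<Rightarrow> (var \<Rightarrow> int) \<Rightarrow> 'a :: field_char_0" where
  "Phi_coeff r rt mu mut q =
     (-1) powi ((\<Sum>i<r. q (X i)) + (\<Sum>i<r. q (Y i)) + (\<Sum>i<rt. q (Xt i)) + (\<Sum>i<rt. q (Yt i)))
     * (\<Prod>j<r. trinom (mu j + q (X j) + q (Y j) + p_ext r rt q (int j - 1) + p_ext r rt q (int j) - 1)
          (q (X j)) (q (Y j)) (p_ext r rt q (int j)))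
     * (\<Prod>j<rt. trinom (mut j + q (Xt j) + q (Yt j) + pt_ext r rt q (int j - 1) + pt_ext r rt q (int j) - 1)
          (q (Xt j)) (q (Yt j)) (pt_ext r rt q (int j)))"

definition Phi :: "nat \<Rightarrow> nat \<Rightarrow> (nat \<Rightarrow> int) \<Rightarrow> (nat \<Rightarrow> int) \<Rightarrow> (var, 'a :: field_char_0) mps" where
  "Phi r rt mu mut = Abs_mps (\<lambda>q. if Poly_Mapping.keys q \<subseteq> vars r rt
     then Phi_coeff r rt mu mut (\<lambda>v. int (Poly_Mapping.lookup q v)) else 0)"


section \<open>Ingredients of the expansion\<close>

definition sigma :: "int \<Rightarrow> int \<Rightarrow> int" where
  "sigma i j = (if i \<le> j then 0 else 1)"

text \<open>\<open>chain X Z i\<close> and \<open>chain Y Z i\<close> are the monomials with exponents \<open>\<ff>\<^sub>i\<close> and \<open>\<gg>\<^sub>i\<close>; the tilde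
  versions are \<open>chain Xt Zt\<close> and \<open>chain Yt Zt\<close>.\<close>

definition chain :: "(nat \<Rightarrow> var) \<Rightarrow> (nat \<Rightarrow> var) \<Rightarrow> int \<Rightarrow> (var, 'a :: field_char_0) mps" where
  "chain U V i = (if i = -1 then 1 else indet (U (nat i)) * (\<Prod>k<nat i. indet (V k)))"

definition pi_vec :: "nat \<Rightarrow> nat \<Rightarrow> (var \<Rightarrow> int) \<Rightarrow> nat \<Rightarrow> int" where
  "pi_vec r rt q j = p_ext r rt q (int j - 1) + p_ext r rt q (int j)"

definition pit_vec :: "nat \<Rightarrow> nat \<Rightarrow> (var \<Rightarrow> int) \<Rightarrow> nat \<Rightarrow> int" where
  "pit_vec r rt q j = pt_ext r rt q (int j - 1) + pt_ext r rt q (int j)"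

definition nu :: "int \<Rightarrow> nat \<Rightarrow> int" where
  "nu i j = 2 * sigma i (int j - 1)"

end

theory Submission
  imports Defs "HOL-Library.Function_Algebras"
begin

text \<open>Put \<open>R\<^sub>j = (1 + w\<^sub>j) / (1 + s\<^sub>j + t\<^sub>j)\<close>. The equations for \<open>\<eta>\<close> say
  \<open>R\<^sub>j = 1 - x\<^sub>j R\<^sub>0 R\<^sub>j - y\<^sub>j R\<^sub>j Rt\<^sub>0 + z\<^sub>j R\<^sub>j R\<^bsub>j+1\<^esub>\<close> together with the tilde analogue, and \<open>\<eta>\<^bsup>q'\<^esup> / \<xi>\<^bsup>q'\<^esup>\<close> is the
  product of the powers of \<open>R\<^sub>j\<close>, \<open>Rt\<^sub>j\<close> with exponent vectors \<open>\<pi>\<close> and \<open>\<pi>t\<close>. Multiplied by such a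
  product, these equations become linear recurrences in the exponent vectors. By the Pascal rule for
  trinomial coefficients \<open>\<Phi>\<close> satisfies the same recurrences, hence so does the right-hand side of
  the theorem, being a combination of shifts of \<open>\<Phi>\<close>. A solution is determined by its value at the
  origin, by induction on the degree in \<open>\<xi>\<close>. There the coefficients of the right-hand side
  are products of trinomial coefficients that differ only by lowered entries, and they cancel because
  \<open>(p\<^bsub>-1\<^esub> - |m|) (pt\<^bsub>-1\<^esub> - |mt|) = |n| |nt|\<close>, except for the constant term \<open>1\<close>.\<close>

section \<open>Order of vanishing of power series\<close>

text \<open>The filtration by total degree. It drives the uniqueness argument: an indeterminate as a
  factor raises the order by one, and only 0 has order at least \<open>d\<close> for every
  \<open>d\<close>.\<close>

definition order_ge :: "nat \<Rightarrow> ('v, 'a :: comm_ring_1) mps \<Rightarrow> bool" where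
  "order_ge d f \<longleftrightarrow> (\<forall>q. mdeg q < d \<longrightarrow> mcoeff f q = 0)"

lemma order_ge_0 [simp]: "order_ge 0 f"
  by (simp add: order_ge_def)

lemma order_ge_add: "order_ge d f \<Longrightarrow> order_ge d g \<Longrightarrow> order_ge d (f + g)"
  by (simp add: order_ge_def)

lemma order_ge_diff: "order_ge d f \<Longrightarrow> order_ge d g \<Longrightarrow> order_ge d (f - g)"
  by (simp add: order_ge_def)

lemma order_ge_mult:
  fixes f g :: "('v, 'a :: comm_ring_1) mps"
  assumes "order_ge d f" "order_ge e g"
  shows "order_ge (d + e) (f * g)"
  unfolding order_ge_def
proof (intro allI impI)
  fix q :: "'v \<Rightarrow>\<^sub>0 nat"
  assume q: "mdeg q < d + e"
  have "mcoeff f a * mcoeff g b = 0" if "(a, b) \<in> splits q" for a b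
  proof -
    have "mdeg a + mdeg b = mdeg q" using that by (auto simp: splits_def mdeg_add)
    hence "mdeg a < d \<or> mdeg b < e" using q by linarith
    thus ?thesis using assms by (auto simp: order_ge_def)
  qed
  thus "mcoeff (f * g) q = 0" by (auto simp: mcoeff_mult intro!: sum.neutral)
qed

lemma order_ge_all_imp_eq_0: "(\<And>d. order_ge d f) \<Longrightarrow> f = 0"
  by (rule mps_eqI) (auto simp: order_ge_def)

lemma mdeg_eq_0_iff: "mdeg q = 0 \<longleftrightarrow> q = 0"
  unfolding mdeg_def by (auto simp: in_keys_iff intro!: poly_mapping_eqI)

lemma order_ge_1_iff: "order_ge (Suc 0) f \<longleftrightarrow> mcoeff f 0 = 0"
  by (simp add: order_ge_def mdeg_eq_0_iff)

lemma mcoeff_indet_0 [simp]: "mcoeff (indet v) 0 = 0"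
  using mcoeff_indet_mult[of v 1 0] by simp

lemma order_ge_indet_mult: "order_ge d f \<Longrightarrow> order_ge (Suc d) (indet v * f)"
  using order_ge_mult[of "Suc 0" "indet v" d f] by (simp add: order_ge_1_iff)

lemma mcoeff_mult_0:
  fixes f g :: "('v, 'a :: comm_ring_1) mps"
  shows "mcoeff (f * g) 0 = mcoeff f 0 * mcoeff g 0"
proof -
  have "splits (0 :: 'v \<Rightarrow>\<^sub>0 nat) = {(0, 0)}"
    by (auto simp: splits_def poly_mapping_eq_iff fun_eq_iff lookup_add)
  thus ?thesis by (simp add: mcoeff_mult)
qed

lemma mcoeff_sum: "mcoeff (sum F A) q = (\<Sum>i\<in>A. mcoeff (F i) q)"
  by (induction A rule: infinite_finite_induct) auto

section \<open>Series with constant term 1 and their images among the fractions\<close>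

text \<open>The inverse is the geometric series in \<open>1 - f\<close>, which has no constant
  term.\<close>

lemma mps_inverse_exists:
  fixes f :: "('v, 'a :: comm_ring_1) mps"
  assumes "mcoeff f 0 = 1"
  obtains g where "f * g = 1" "mcoeff g 0 = 1"
proof -
  \<comment> \<open>Since \<open>(1 - f) ^ n\<close> has order at least \<open>n\<close>, cutting
    the sum at \<open>mdeg q\<close> loses nothing.\<close>
  define g where "g = Abs_mps (\<lambda>q. \<Sum>n\<le>mdeg q. mcoeff ((1 - f) ^ n) q)"
  have ord: "order_ge n ((1 - f) ^ n)" for n
  proof (induction n)
    case (Suc n)
    have "order_ge (Suc 0) (1 - f)" using assms by (simp add: order_ge_1_iff)
    from order_ge_mult[OF this Suc] show ?case by simp
  qed simp
  have tail: "order_ge N (g - (\<Sum>n<N. (1 - f) ^ n))" for N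
    unfolding order_ge_def
  proof (intro allI impI)
    fix q :: "'v \<Rightarrow>\<^sub>0 nat"
  assume q: "mdeg q < N"
    have "(\<Sum>n<N. mcoeff ((1 - f) ^ n) q) = (\<Sum>n\<le>mdeg q. mcoeff ((1 - f) ^ n) q)"
      using q ord by (intro sum.mono_neutral_right) (auto simp: order_ge_def)
    thus "mcoeff (g - (\<Sum>n<N. (1 - f) ^ n)) q = 0"
      by (simp add: g_def mcoeff_sum)
  qed
  have "f * g - 1 = 0"
  proof (rule order_ge_all_imp_eq_0)
    fix N
    have "f * (\<Sum>n<N. (1 - f) ^ n) = 1 - (1 - f) ^ N"
      by (induction N) (simp_all add: algebra_simps)
    hence "f * g - 1 = f * (g - (\<Sum>n<N. (1 - f) ^ n)) - (1 - f) ^ N"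
      by (simp add: algebra_simps)
    moreover have "order_ge N (f * (g - (\<Sum>n<N. (1 - f) ^ n)))"
      using order_ge_mult[OF order_ge_0 tail[of N]] by simp
    ultimately show "order_ge N (f * g - 1)"
      using ord[of N] by (metis order_ge_diff)
  qed
  moreover from this have "mcoeff g 0 = 1"
    using assms mcoeff_mult_0[of f g] by simp
  ultimately show ?thesis using that[of g] by simp
qed

text \<open>A subgroup of the multiplicative group of the fraction field. Integer powers of its
  elements, negative ones included, are still images of power series.\<close>

definition unit_series :: "('v :: linorder, 'a :: field_char_0) mps fract set" where
  "unit_series = to_fract ` {f. mcoeff f 0 = 1}"

lemma unit_series_mult: "a \<in> unit_series \<Longrightarrow> b \<in> unit_series \<Longrightarrow> a * b \<in> unit_series"
  unfolding unit_series_def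
  by (auto simp: mcoeff_mult_0 simp flip: to_fract_mult)

lemma unit_series_1: "1 \<in> unit_series"
  unfolding unit_series_def by (auto intro!: image_eqI[of _ _ 1])

lemma unit_series_inverse: "a \<in> unit_series \<Longrightarrow> inverse a \<in> unit_series"
proof -
  assume "a \<in> unit_series"
  then obtain f where f: "a = to_fract f" "mcoeff f 0 = 1" by (auto simp: unit_series_def)
  obtain g where g: "f * g = 1" "mcoeff g 0 = 1" using mps_inverse_exists[OF f(2)] .
  have "a * to_fract g = 1" using f g by (simp flip: to_fract_mult)
  hence "inverse a = to_fract g" by (rule inverse_unique)
  thus ?thesis using g by (auto simp: unit_series_def)
qed

lemma unit_series_divide: "a \<in> unit_series \<Longrightarrow> b \<in> unit_series \<Longrightarrow> a / b \<in> unit_series"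
  by (simp add: divide_inverse unit_series_mult unit_series_inverse)

lemma unit_series_power: "a \<in> unit_series \<Longrightarrow> a ^ n \<in> unit_series"
  by (induction n) (auto intro: unit_series_1 unit_series_mult)

lemma unit_series_power_int: "a \<in> unit_series \<Longrightarrow> a powi k \<in> unit_series"
  by (simp add: power_int_def unit_series_power unit_series_inverse)

lemma unit_series_prod: "(\<And>i. i \<in> A \<Longrightarrow> f i \<in> unit_series) \<Longrightarrow> prod f A \<in> unit_series"
  by (induction A rule: infinite_finite_induct) (auto intro: unit_series_1 unit_series_mult)

lemma unit_series_nonzero: "a \<in> unit_series \<Longrightarrow> a \<noteq> 0"
  by (auto simp: unit_series_def)


section \<open>The recurrences and uniqueness of their solutions\<close>

definition unit_vec :: "nat \<Rightarrow> nat \<Rightarrow> int" where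
  "unit_vec j = (\<lambda>i. of_bool (i = j))"

text \<open>The equation for \<open>R_j\<close> multiplied by powers with exponent vectors \<mu> and
  \<nu>. The tilde equations are the same predicate with other labels and the two arguments of
  \<open>E\<close> exchanged. The conditional reflects \<open>w_{r-1} = 0\<close>.\<close>

definition half_rec :: "nat \<Rightarrow> (nat \<Rightarrow> 'v) \<Rightarrow> (nat \<Rightarrow> 'v) \<Rightarrow> (nat \<Rightarrow> 'v)
    \<Rightarrow> ((nat \<Rightarrow> int) \<Rightarrow> (nat \<Rightarrow> int) \<Rightarrow> ('v, 'a :: comm_ring_1) mps) \<Rightarrow> bool" where
  "half_rec r U V W E \<longleftrightarrow> (\<forall>\<mu> \<nu>. \<forall>j<r. E (\<mu> + unit_vec j) \<nu> = E \<mu> \<nu>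
     - indet (U j) * E (\<mu> + unit_vec j + unit_vec 0) \<nu>
     - indet (V j) * E (\<mu> + unit_vec j) (\<nu> + unit_vec 0)
     + (if Suc j < r then indet (W j) * E (\<mu> + unit_vec j + unit_vec (Suc j)) \<nu> else 0))"

lemma half_recD:
  "half_rec r U V W E \<Longrightarrow> j < r \<Longrightarrow> E (\<mu> + unit_vec j) \<nu> = E \<mu> \<nu>
     - indet (U j) * E (\<mu> + unit_vec j + unit_vec 0) \<nu>
     - indet (V j) * E (\<mu> + unit_vec j) (\<nu> + unit_vec 0)
     + (if Suc j < r then indet (W j) * E (\<mu> + unit_vec j + unit_vec (Suc j)) \<nu> else 0)"
  unfolding half_rec_def by blast

text \<open>The coefficients of the recurrence do not depend on \<mu> and \<nu>, so solutions may be
  translated. With the linearity lemmas below this carries the recurrences from \<open>Phi\<close>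
  to the expansion.\<close>

lemma half_rec_shift:
  assumes "half_rec r U V W E"
  shows "half_rec r U V W (\<lambda>\<mu> \<nu>. E (\<mu> + a) (\<nu> + b))"
  unfolding half_rec_def
proof (intro allI impI, goal_cases)
  case (1 \<mu> \<nu> j)
  show ?case
    unfolding add.commute[of _ a] add.commute[of _ b] add.assoc[symmetric]
    unfolding add.assoc[of a] add.assoc[of b]
    using half_recD[OF assms 1, of "a + \<mu>" "b + \<nu>"] unfolding add.assoc .
qed

lemma half_rec_cmult:
  assumes "half_rec r U V W E"
  shows "half_rec r U V W (\<lambda>\<mu> \<nu>. c * E \<mu> \<nu>)"
  unfolding half_rec_def
proof (intro allI impI, goal_cases)
  case (1 \<mu> \<nu> j)
  show ?case
    by (subst half_recD[OF assms 1]) (simp add: algebra_simps)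
qed

lemma half_rec_zero: "half_rec r U V W (\<lambda>\<mu> \<nu>. 0)"
  by (simp add: half_rec_def)

lemma half_rec_add:
  assumes "half_rec r U V W E" "half_rec r U V W F"
  shows "half_rec r U V W (\<lambda>\<mu> \<nu>. E \<mu> \<nu> + F \<mu> \<nu>)"
  unfolding half_rec_def
proof (intro allI impI, goal_cases)
  case (1 \<mu> \<nu> j)
  show ?case
    by (subst half_recD[OF assms(1) 1], subst half_recD[OF assms(2) 1]) (simp add: algebra_simps)
qed

lemma half_rec_diff:
  assumes "half_rec r U V W E" "half_rec r U V W F"
  shows "half_rec r U V W (\<lambda>\<mu> \<nu>. E \<mu> \<nu> - F \<mu> \<nu>)"
  using half_rec_add[OF assms(1) half_rec_cmult[OF assms(2), of "-1"]] by simp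

lemma half_rec_sum:
  "(\<And>i. i \<in> A \<Longrightarrow> half_rec r U V W (E i)) \<Longrightarrow> half_rec r U V W (\<lambda>\<mu> \<nu>. \<Sum>i\<in>A. E i \<mu> \<nu>)"
  by (induction A rule: infinite_finite_induct) (simp_all add: half_rec_zero half_rec_add)

text \<open>Each coordinate below \<open>n\<close> is moved to 0 by integer induction in both
  directions, hence the equivalence in \<open>step\<close>; \<open>cong\<close> disposes of the
  coordinates from \<open>n\<close> on.\<close>

lemma invariant_imp_at_zero:
  fixes P :: "(nat \<Rightarrow> int) \<Rightarrow> bool"
  assumes step: "\<And>j \<mu>. j < n \<Longrightarrow> P (\<mu> + unit_vec j) \<longleftrightarrow> P \<mu>"
    and cong: "\<And>\<mu> \<mu>'. (\<And>j. j < n \<Longrightarrow> \<mu> j = \<mu>' j) \<Longrightarrow> P \<mu> \<longleftrightarrow> P \<mu>'"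
  shows "P \<mu> \<longleftrightarrow> P 0"
proof -
  have multi: "P (\<mu>(j := k)) \<longleftrightarrow> P (\<mu>(j := 0))" if "j < n" for j k \<mu>
  proof (induction k rule: int_induct[where k = 0])
    case base
    show ?case by simp
  next
    case (step1 i)
    have "\<mu>(j := i + 1) = \<mu>(j := i) + unit_vec j" by (auto simp: unit_vec_def plus_fun_def)
    thus ?case using step1 step[OF that] by metis
  next
    case (step2 i)
    have "\<mu>(j := i) = \<mu>(j := i - 1) + unit_vec j" by (auto simp: unit_vec_def plus_fun_def)
    thus ?case using step2 step[OF that] by metis
  qed
  have "P \<mu> \<longleftrightarrow> P (\<lambda>j. if j < k then 0 else \<mu> j)" if "k \<le> n" for k
    using that
  proof (induction k)
    case (Suc k)
    let ?f = "\<lambda>j. if j < k then 0 else \<mu> j"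
    have "(\<lambda>j. if j < Suc k then 0 else \<mu> j) = ?f(k := 0)" by (auto simp: less_Suc_eq)
    moreover have "?f = ?f(k := \<mu> k)" by auto
    ultimately show ?case using Suc multi[of k ?f "\<mu> k"] by simp
  qed simp
  from this[of n] show ?thesis using cong[of "\<lambda>j. if j < n then 0 else \<mu> j" 0] by simp
qed

text \<open>All terms on the right of the recurrence except \<open>E \<mu> \<nu>\<close> carry an
  indeterminate, hence have order at least \<open>Suc d\<close>.\<close>

lemma half_rec_order:
  assumes "half_rec r U V W E" "\<And>\<mu> \<nu>. order_ge d (E \<mu> \<nu>)" "j < r"
  shows "order_ge (Suc d) (E (\<mu> + unit_vec j) \<nu>) \<longleftrightarrow> order_ge (Suc d) (E \<mu> \<nu>)"
proof -
  define D where "D = 0 - indet (U j) * E (\<mu> + unit_vec j + unit_vec 0) \<nu>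
     - indet (V j) * E (\<mu> + unit_vec j) (\<nu> + unit_vec 0)
     + (if Suc j < r then indet (W j) * E (\<mu> + unit_vec j + unit_vec (Suc j)) \<nu> else 0)"
  have ord: "order_ge (Suc d) (indet v * E \<mu> \<nu>)" for v \<mu> \<nu>
    by (intro order_ge_indet_mult assms(2))
  have D: "order_ge (Suc d) D"
    unfolding D_def using ord by (simp add: order_ge_def)
  have E: "E (\<mu> + unit_vec j) \<nu> = E \<mu> \<nu> + D"
    unfolding D_def by (subst half_recD[OF assms(1,3)]) simp
  show ?thesis
    unfolding E by (metis D order_ge_add order_ge_diff add_diff_cancel_right')
qed

text \<open>Once all values have order at least \<open>d\<close>, unit steps do not affect whether a
  value has order at least \<open>Suc d\<close>, so the question reduces to
  \<open>E 0 0\<close>.\<close>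

lemma half_rec_unique:
  assumes rec: "half_rec r U V W E" "half_rec rt Ut Vt Wt (\<lambda>\<nu> \<mu>. E \<mu> \<nu>)"
    and cong: "\<And>\<mu> \<mu>' \<nu> \<nu>'. (\<And>j. j < r \<Longrightarrow> \<mu> j = \<mu>' j) \<Longrightarrow> (\<And>j. j < rt \<Longrightarrow> \<nu> j = \<nu>' j)
      \<Longrightarrow> E \<mu> \<nu> = E \<mu>' \<nu>'"
    and zero: "E 0 0 = 0"
  shows "E \<mu> \<nu> = 0"
proof -
  have "\<forall>\<mu> \<nu>. order_ge d (E \<mu> \<nu>)" for d
  proof (induction d)
    case (Suc d)
    hence IH: "order_ge d (E \<mu> \<nu>)" for \<mu> \<nu> by blast
    show ?case
    proof (intro allI)
      fix \<mu> \<nu>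
      have "order_ge (Suc d) (E \<mu> \<nu>) \<longleftrightarrow> order_ge (Suc d) (E 0 \<nu>)"
      proof (rule invariant_imp_at_zero[where n = r])
        fix \<mu> \<mu>' :: "nat \<Rightarrow> int" assume "\<And>j. j < r \<Longrightarrow> \<mu> j = \<mu>' j"
        hence "E \<mu> \<nu> = E \<mu>' \<nu>" by (intro cong) auto
        thus "order_ge (Suc d) (E \<mu> \<nu>) \<longleftrightarrow> order_ge (Suc d) (E \<mu>' \<nu>)" by simp
      qed (rule half_rec_order[OF rec(1) IH])
      also have "\<dots> \<longleftrightarrow> order_ge (Suc d) (E 0 0)"
      proof (rule invariant_imp_at_zero[where n = rt])
        fix \<nu> \<nu>' :: "nat \<Rightarrow> int" assume "\<And>j. j < rt \<Longrightarrow> \<nu> j = \<nu>' j"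
        hence "E 0 \<nu> = E 0 \<nu>'" by (intro cong) auto
        thus "order_ge (Suc d) (E 0 \<nu>) \<longleftrightarrow> order_ge (Suc d) (E 0 \<nu>')" by simp
      qed (rule half_rec_order[OF rec(2) IH])
      finally show "order_ge (Suc d) (E \<mu> \<nu>)" by (simp add: zero order_ge_def)
    qed
  qed simp
  thus ?thesis by (intro order_ge_all_imp_eq_0) blast
qed


section \<open>Products of trinomial coefficients\<close>

lemma trinom_negative: "m < 0 \<or> n < 0 \<or> p < 0 \<Longrightarrow> trinom a m n p = 0"
  by (auto simp: trinom_def)

lemma trinom_000 [simp]: "trinom a 0 0 0 = 1"
  by (simp add: trinom_def)

text \<open>If an entry is negative, all five coefficients vanish; hence the Pascal rule has no
  boundary cases.\<close>

lemma trinom_step_int: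
  "trinom (a + 1) m n p = trinom a m n p + trinom a (m - 1) n p + trinom a m (n - 1) p
     + trinom a m n (p - 1)"
proof (cases "m < 0 \<or> n < 0 \<or> p < 0")
  case True
  hence "m - 1 < 0 \<or> n < 0 \<or> p < 0" "m < 0 \<or> n - 1 < 0 \<or> p < 0" "m < 0 \<or> n < 0 \<or> p - 1 < 0"
    by auto
  with True show ?thesis by (simp only: trinom_negative add_0)
next
  case False
  thus ?thesis using trinom_step[of a "nat m" "nat n" "nat p"] by simp
qed

text \<open>One of the two products in the coefficients of \<open>Phi\<close>. The sequence
  \<open>p\<close> is indexed from 0 instead of -1: \<open>p 0\<close> is \<open>p_{-1}\<close> and
  \<open>p n\<close> is \<open>p_{n-1}\<close>.\<close>

definition block :: "nat \<Rightarrow> (nat \<Rightarrow> int) \<Rightarrow> (nat \<Rightarrow> int) \<Rightarrow> (nat \<Rightarrow> int) \<Rightarrow> (nat \<Rightarrow> int)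
    \<Rightarrow> 'a :: field_char_0" where
  "block n \<mu> m k p =
     (\<Prod>j<n. trinom (\<mu> j + m j + k j + p j + p (Suc j) - 1) (m j) (k j) (p (Suc j)))"

lemma block_negative:
  "j < n \<Longrightarrow> m j < 0 \<or> k j < 0 \<or> p (Suc j) < 0 \<Longrightarrow> block n \<mu> m k p = 0"
  unfolding block_def by (intro prod_zero) (auto intro!: bexI[of _ j] trinom_negative)

lemma block_cong:
  assumes "\<And>j. j < n \<Longrightarrow> \<mu> j = \<mu>' j" "\<And>j. j < n \<Longrightarrow> m j = m' j" "\<And>j. j < n \<Longrightarrow> k j = k' j"
    "\<And>j. j \<le> n \<Longrightarrow> p j = p' j"
  shows "block n \<mu> m k p = block n \<mu>' m' k' p'"
  unfolding block_def by (intro prod.cong refl) (use assms in auto)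

text \<open>\<open>p 0\<close> occurs in a single place, the upper argument for
  \<open>j = 0\<close>, where it is added to \<open>\<mu> 0\<close>.\<close>

lemma block_decrement_0: "block n (\<mu> + unit_vec 0) m k (p - unit_vec 0) = block n \<mu> m k p"
  unfolding block_def by (intro prod.cong refl) (auto simp: unit_vec_def algebra_simps)

text \<open>The Pascal rule in the factor \<open>j\<close>. Lowering \<open>p (Suc j)\<close> also
  affects the upper argument of the factor \<open>Suc j\<close>, which the extra
  \<open>unit_vec (Suc j)\<close> compensates; so all other factors are common to the terms.\<close>

lemma block_step:
  assumes "j < n"
  shows "block n (\<mu> + unit_vec j) m k p = block n \<mu> m k p
    + block n (\<mu> + unit_vec j) (m - unit_vec j) k p
    + block n (\<mu> + unit_vec j) m (k - unit_vec j) p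
    + (block n (\<mu> + unit_vec j + unit_vec (Suc j)) m k (p - unit_vec (Suc j)) :: 'a :: field_char_0)"
proof -
  define a where "a i = \<mu> i + m i + k i + p i + p (Suc i) - 1" for i
  define rest where "rest = (\<Prod>i\<in>{..<n} - {j}. trinom (a i) (m i) (k i) (p (Suc i)) :: 'a)"
  have split: "block n \<mu>' m' k' p' = trinom b (m' j) (k' j) (p' (Suc j)) * rest"
    if "\<mu>' j + m' j + k' j + p' j + p' (Suc j) - 1 = b"
      "\<And>i. i \<noteq> j \<Longrightarrow> \<mu>' i + m' i + k' i + p' i + p' (Suc i) - 1 = a i \<and> m' i = m i \<and> k' i = k i
         \<and> p' (Suc i) = p (Suc i)" for \<mu>' m' k' p' b
  proof -
    have "(\<Prod>i\<in>{..<n} - {j}. trinom (\<mu>' i + m' i + k' i + p' i + p' (Suc i) - 1) (m' i) (k' i) (p' (Suc i)))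
        = rest"
      unfolding rest_def
    proof (intro prod.cong refl)
      fix i assume "i \<in> {..<n} - {j}"
      hence "i \<noteq> j" by simp
      from that(2)[OF this]
      show "trinom (\<mu>' i + m' i + k' i + p' i + p' (Suc i) - 1) (m' i) (k' i) (p' (Suc i))
          = (trinom (a i) (m i) (k i) (p (Suc i)) :: 'a)"
        by (elim conjE) (simp only:)
    qed
    thus ?thesis
      unfolding block_def using assms that(1) by (subst prod.remove[of _ j]) auto
  qed
  have "block n (\<mu> + unit_vec j) m k p = trinom (a j + 1) (m j) (k j) (p (Suc j)) * rest"
    by (rule split) (auto simp: unit_vec_def a_def)
  moreover have "block n \<mu> m k p = trinom (a j) (m j) (k j) (p (Suc j)) * rest"
    by (rule split) (auto simp: unit_vec_def a_def)
  moreover have "block n (\<mu> + unit_vec j) (m - unit_vec j) k p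
      = trinom (a j) ((m - unit_vec j) j) (k j) (p (Suc j)) * rest"
    by (rule split) (auto simp: unit_vec_def a_def)
  moreover have "block n (\<mu> + unit_vec j) m (k - unit_vec j) p
      = trinom (a j) (m j) ((k - unit_vec j) j) (p (Suc j)) * rest"
    by (rule split) (auto simp: unit_vec_def a_def)
  moreover have "block n (\<mu> + unit_vec j + unit_vec (Suc j)) m k (p - unit_vec (Suc j))
      = trinom (a j) (m j) (k j) ((p - unit_vec (Suc j)) (Suc j)) * rest"
    by (rule split) (auto simp: unit_vec_def a_def)
  ultimately show ?thesis
    by (simp add: trinom_step_int[of "a j"] unit_vec_def distrib_right)
qed

section \<open>Sums of blocks with lowered entries\<close>

definition block_arg :: "(nat \<Rightarrow> int) \<Rightarrow> (nat \<Rightarrow> int) \<Rightarrow> (nat \<Rightarrow> int) \<Rightarrow> nat \<Rightarrow> int" where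
  "block_arg m k p j = m j + k j + p j + p (Suc j) - 1"

text \<open>The summand \<open>i\<close> belongs to the monomial \<open>x_i z_0 ... z_{i-1}\<close>,
  whose exponents lower the entries. The upper arguments keep their values because
  \<open>nu i\<close> will make up for the lowering.\<close>

definition block_sum_m :: "nat \<Rightarrow> (nat \<Rightarrow> int) \<Rightarrow> (nat \<Rightarrow> int) \<Rightarrow> (nat \<Rightarrow> int) \<Rightarrow> 'a :: field_char_0" where
  "block_sum_m n m k p = (\<Sum>i<n. \<Prod>j<n.
     trinom (block_arg m k p j) (m j - of_bool (j = i)) (k j) (p (Suc j) - of_bool (j < i)))"

definition block_sum_k :: "nat \<Rightarrow> (nat \<Rightarrow> int) \<Rightarrow> (nat \<Rightarrow> int) \<Rightarrow> (nat \<Rightarrow> int) \<Rightarrow> 'a :: field_char_0" where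
  "block_sum_k n m k p = (\<Sum>i<n. \<Prod>j<n.
     trinom (block_arg m k p j) (m j) (k j - of_bool (j = i)) (p (Suc j) - of_bool (j < i)))"

text \<open>Up to a common factor, lowering an entry of a trinomial coefficient multiplies it by that
  entry, while the upper argument is such that the full coefficient is multiplied by the preceding
  \<open>p\<close>. The exception occurs when all four numbers are \<open>0\<close>.\<close>

lemma trinom_common_factor:
  fixes m k p p0 :: int
  assumes "m \<ge> 0" "k \<ge> 0" "p \<ge> 0" "p0 \<ge> 0"
  defines "a \<equiv> m + k + p0 + p - 1"
  obtains (factor) P :: "'a :: field_char_0" where
      "trinom a m k p = of_int p0 * P" "trinom a (m - 1) k p = of_int m * P"
      "trinom a m (k - 1) p = of_int k * P" "trinom a m k (p - 1) = of_int p * P"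
    | (zero) "m = 0" "k = 0" "p = 0" "p0 = 0"
proof (cases "nat m + nat k + nat p")
  case 0
  hence z: "m = 0" "k = 0" "p = 0" using assms by auto
  show ?thesis
  proof (cases "p0 = 0")
    case False
    \<comment> \<open>With all three entries 0 the coefficient is 1 and the lowered ones vanish,
      which forces this \<open>P\<close>.\<close>
    thus ?thesis using z by (intro factor[of "1 / of_int p0"]) (auto simp: trinom_negative)
  qed (use zero z in blast)
next
  case (Suc l)
  define P :: 'a where "P = (\<Prod>i<l. of_int a - of_nat i) / (fact (nat m) * fact (nat k) * fact (nat p))"
  \<comment> \<open>This is the last factor of the falling product of length
    \<open>Suc l\<close>.\<close>
  have "a - int l = p0" using Suc assms by (simp add: a_def)
  hence "of_int a - of_nat l = (of_int p0 :: 'a)" by (metis of_int_diff of_int_of_nat_eq)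
  thus ?thesis
    using trinom_lower(1-4)[OF Suc, of a, where 'a = 'a] assms(1-3)
    by (intro factor[of P]) (simp_all add: P_def)
qed

text \<open>Induction on \<open>n\<close>, splitting off the factor \<open>j = 0\<close> and using
  \<open>trinom_common_factor\<close> there. The case \<open>zero\<close> is the one where all
  entries vanish and the product is 1 although \<open>p 0 = 0\<close>.\<close>

lemma block_sums:
  fixes m k p :: "nat \<Rightarrow> int"
  assumes "\<And>j. j < n \<Longrightarrow> m j \<ge> 0" "\<And>j. j < n \<Longrightarrow> k j \<ge> 0" "\<And>j. j \<le> n \<Longrightarrow> p j \<ge> 0" "p n = 0"
  obtains (factor) K :: "'a :: field_char_0" where
      "block n 0 m k p = of_int (p 0) * K"
      "block_sum_m n m k p = of_int (\<Sum>j<n. m j) * K"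
      "block_sum_k n m k p = of_int (\<Sum>j<n. k j) * K"
    | (zero) "block n 0 m k p = (1 :: 'a)" "block_sum_m n m k p = (0 :: 'a)"
      "block_sum_k n m k p = (0 :: 'a)" "\<And>j. j < n \<Longrightarrow> m j = 0 \<and> k j = 0" "\<And>j. j \<le> n \<Longrightarrow> p j = 0"
proof -
  have "(\<exists>K :: 'a. block n 0 m k p = of_int (p 0) * K \<and>
      block_sum_m n m k p = of_int (\<Sum>j<n. m j) * K \<and>
      block_sum_k n m k p = of_int (\<Sum>j<n. k j) * K) \<or>
    (block n 0 m k p = (1 :: 'a) \<and> block_sum_m n m k p = (0 :: 'a) \<and>
      block_sum_k n m k p = (0 :: 'a) \<and> (\<forall>j<n. m j = 0 \<and> k j = 0) \<and> (\<forall>j\<le>n. p j = 0))"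
    using assms
  proof (induction n arbitrary: m k p)
    case 0
    thus ?case by (simp add: block_def block_sum_m_def block_sum_k_def)
  next
    case (Suc n)
    define m' k' p' where "m' = m \<circ> Suc" and "k' = k \<circ> Suc" and "p' = p \<circ> Suc"
    let ?a = "m 0 + k 0 + p 0 + p (Suc 0) - 1"
    have T: "block (Suc n) 0 m k p = trinom ?a (m 0) (k 0) (p (Suc 0)) * (block n 0 m' k' p' :: 'a)"
      by (simp add: block_def prod.lessThan_Suc_shift m'_def k'_def p'_def del: prod.lessThan_Suc)
    \<comment> \<open>Only the summand \<open>i = 0\<close> lowers \<open>m 0\<close>; each of the
      others lowers \<open>p (Suc 0)\<close> in the first factor.\<close>
    have M: "block_sum_m (Suc n) m k p = trinom ?a (m 0 - 1) (k 0) (p (Suc 0)) * block n 0 m' k' p'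
        + trinom ?a (m 0) (k 0) (p (Suc 0) - 1) * (block_sum_m n m' k' p' :: 'a)"
      by (simp add: block_def block_sum_m_def block_arg_def prod.lessThan_Suc_shift sum.lessThan_Suc_shift
          m'_def k'_def p'_def sum_distrib_left del: prod.lessThan_Suc sum.lessThan_Suc)
    have N: "block_sum_k (Suc n) m k p = trinom ?a (m 0) (k 0 - 1) (p (Suc 0)) * block n 0 m' k' p'
        + trinom ?a (m 0) (k 0) (p (Suc 0) - 1) * (block_sum_k n m' k' p' :: 'a)"
      by (simp add: block_def block_sum_k_def block_arg_def prod.lessThan_Suc_shift sum.lessThan_Suc_shift
          m'_def k'_def p'_def sum_distrib_left del: prod.lessThan_Suc sum.lessThan_Suc)
    have S: "(\<Sum>j<Suc n. m j) = m 0 + (\<Sum>j<n. m' j)" "(\<Sum>j<Suc n. k j) = k 0 + (\<Sum>j<n. k' j)"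
      by (simp_all add: sum.lessThan_Suc_shift m'_def k'_def del: sum.lessThan_Suc)
    have p'0: "p' 0 = p (Suc 0)" by (simp add: p'_def)
    have IH: "(\<exists>K :: 'a. block n 0 m' k' p' = of_int (p' 0) * K \<and>
        block_sum_m n m' k' p' = of_int (\<Sum>j<n. m' j) * K \<and>
        block_sum_k n m' k' p' = of_int (\<Sum>j<n. k' j) * K) \<or>
      (block n 0 m' k' p' = (1 :: 'a) \<and> block_sum_m n m' k' p' = (0 :: 'a) \<and>
        block_sum_k n m' k' p' = (0 :: 'a) \<and> (\<forall>j<n. m' j = 0 \<and> k' j = 0) \<and> (\<forall>j\<le>n. p' j = 0))"
      by (rule Suc.IH) (use Suc.prems in \<open>auto simp: m'_def k'_def p'_def\<close>)
    have nonneg: "m 0 \<ge> 0" "k 0 \<ge> 0" "p (Suc 0) \<ge> 0" "p 0 \<ge> 0" using Suc.prems by auto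
    show ?case
    proof (cases rule: trinom_common_factor[OF nonneg, where 'a = 'a, case_names factor zero])
      case (factor P)
      from IH show ?thesis
      proof (elim disjE exE conjE, goal_cases)
        case (1 K)
        \<comment> \<open>The unlowered tail and the first factor with lowered
          \<open>p (Suc 0)\<close> both contribute \<open>p (Suc 0)\<close>, which goes into the new
          common factor; \<open>m 0\<close> is added to the sum of \<open>m'\<close>.\<close>
        thus ?case unfolding T M N S p'0 factor
          by (intro disjI1 exI[of _ "of_int (p (Suc 0)) * P * K"]) (auto simp: algebra_simps)
      next
        case 2
        hence "(\<Sum>j<n. m' j) = 0" "(\<Sum>j<n. k' j) = 0" by auto
        with 2 show ?case unfolding T M N S factor
          by (intro disjI1 exI[of _ P]) (auto simp: algebra_simps)
      qed
    next
      case zero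
      from IH show ?thesis
      proof (elim disjE exE conjE, goal_cases)
        case (1 K)
        \<comment> \<open>The lowered first factors vanish, and the unlowered tail is a multiple of
          \<open>p (Suc 0) = 0\<close>; all three quantities are 0.\<close>
        thus ?case unfolding T M N p'0
          by (intro disjI1 exI[of _ 0]) (simp add: zero trinom_negative)
      next
        case 2
        have "m j = 0 \<and> k j = 0" if "j < Suc n" for j
          using that 2 zero by (cases j) (auto simp: m'_def k'_def)
        moreover have "p j = 0" if "j \<le> Suc n" for j
          using that 2 zero by (cases j) (auto simp: p'_def)
        ultimately show ?case using 2 zero unfolding T M N
          by (intro disjI2) (auto simp: trinom_negative)
      qed
    qed
  qed
  thus ?thesis using factor zero by blast
qed


section \<open>The recurrences for \<open>\<Phi>\<close>\<close>

text \<open>Coefficient functions live on integer multi-indices and vanish when some exponent is negative,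
  so that multiplication by an indeterminate is a plain shift.\<close>

definition series_of :: "'v set \<Rightarrow> (('v \<Rightarrow> int) \<Rightarrow> 'a) \<Rightarrow> ('v, 'a :: comm_ring_1) mps" where
  "series_of V g = Abs_mps (\<lambda>q. if Poly_Mapping.keys q \<subseteq> V
     then g (\<lambda>v. int (Poly_Mapping.lookup q v)) else 0)"

lemma mcoeff_series_of:
  "mcoeff (series_of V g) q =
     (if Poly_Mapping.keys q \<subseteq> V then g (\<lambda>v. int (Poly_Mapping.lookup q v)) else 0)"
  by (simp add: series_of_def)

definition decrement :: "'v set \<Rightarrow> ('v \<Rightarrow> int) \<Rightarrow> 'v \<Rightarrow> int" where
  "decrement S q = (\<lambda>u. q u - of_bool (u \<in> S))"

lemma indet_mult_series_of:
  assumes "v \<in> V" "\<And>q. q v < 0 \<Longrightarrow> g q = 0"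
  shows "indet v * series_of V g = series_of V (\<lambda>q. g (decrement {v} q))"
proof (rule mps_eqI)
  fix q
  show "mcoeff (indet v * series_of V g) q = mcoeff (series_of V (\<lambda>q. g (decrement {v} q))) q"
  proof (cases "Poly_Mapping.lookup q v = 0")
    case True
    thus ?thesis by (simp add: mcoeff_indet_mult mcoeff_series_of assms(2) decrement_def)
  next
    case False
    have "Poly_Mapping.keys q = insert v (Poly_Mapping.keys (q - Poly_Mapping.single v 1))"
      using False by (auto simp: in_keys_iff lookup_minus lookup_single when_def split: if_splits)
    moreover have "(\<lambda>u. int (Poly_Mapping.lookup (q - Poly_Mapping.single v 1) u))
        = decrement {v} (\<lambda>u. int (Poly_Mapping.lookup q u))"
      using False by (auto simp: decrement_def lookup_minus lookup_single when_def fun_eq_iff)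
    ultimately show ?thesis
      using assms(1) False by (simp add: mcoeff_indet_mult mcoeff_series_of)
  qed
qed

lemma prod_indet_mult_series_of:
  assumes "finite S" "S \<subseteq> V" "\<And>q v. v \<in> V \<Longrightarrow> q v < 0 \<Longrightarrow> g q = 0"
  shows "prod indet S * series_of V g = series_of V (\<lambda>q. g (decrement S q))"
  using assms(1,2)
proof (induction S rule: finite_induct)
  case empty
  show ?case by (simp add: decrement_def)
next
  case (insert v S)
  have "prod indet (insert v S) * series_of V g = indet v * series_of V (\<lambda>q. g (decrement S q))"
    using insert by (simp add: mult.assoc)
  also have "\<dots> = series_of V (\<lambda>q. g (decrement S (decrement {v} q)))"
    using insert.prems by (intro indet_mult_series_of) (auto simp: decrement_def intro!: assms(3)[of v])
  also have "(\<lambda>q. g (decrement S (decrement {v} q))) = (\<lambda>q. g (decrement (insert v S) q))"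
    using insert.hyps by (intro ext arg_cong[where f = g]) (auto simp: decrement_def)
  finally show ?case .
qed

section \<open>Coefficients of \<open>Phi\<close> as a sign times two blocks\<close>

definition p_seq :: "nat \<Rightarrow> nat \<Rightarrow> (var \<Rightarrow> int) \<Rightarrow> nat \<Rightarrow> int" where
  "p_seq r rt q = (\<lambda>i. p_ext r rt q (int i - 1))"

definition pt_seq :: "nat \<Rightarrow> nat \<Rightarrow> (var \<Rightarrow> int) \<Rightarrow> nat \<Rightarrow> int" where
  "pt_seq r rt q = (\<lambda>i. pt_ext r rt q (int i - 1))"

definition total :: "nat \<Rightarrow> nat \<Rightarrow> (var \<Rightarrow> int) \<Rightarrow> int" where
  "total r rt q = (\<Sum>i<r. q (X i)) + (\<Sum>i<r. q (Y i)) + (\<Sum>i<rt. q (Xt i)) + (\<Sum>i<rt. q (Yt i))"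

lemma Phi_coeff_block:
  "Phi_coeff r rt \<mu> \<nu> q = (-1) powi total r rt q
     * block r \<mu> (\<lambda>j. q (X j)) (\<lambda>j. q (Y j)) (p_seq r rt q)
     * block rt \<nu> (\<lambda>j. q (Xt j)) (\<lambda>j. q (Yt j)) (pt_seq r rt q)"
  by (simp add: Phi_coeff_def block_def p_seq_def pt_seq_def total_def)

lemma Phi_series_of: "Phi r rt \<mu> \<nu> = series_of (vars r rt) (Phi_coeff r rt \<mu> \<nu>)"
  by (simp add: Phi_def series_of_def)

text \<open>Every exponent is a lower entry of some trinomial coefficient; that of
  \<open>Z j\<close> is \<open>p_seq\<close> at \<open>Suc j\<close>.\<close>

lemma Phi_coeff_negative:
  assumes "v \<in> vars r rt" "q v < 0"
  shows "Phi_coeff r rt \<mu> \<nu> q = 0"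
proof -
  consider j where "j < r" "v = X j" | j where "j < r" "v = Y j" | j where "Suc j < r" "v = Z j"
    | j where "j < rt" "v = Xt j" | j where "j < rt" "v = Yt j" | j where "Suc j < rt" "v = Zt j"
    using assms(1) by (auto simp: vars_def less_diff_conv)
  thus ?thesis
  proof cases
    case (3 j)
    hence "block r \<mu> (\<lambda>j. q (X j)) (\<lambda>j. q (Y j)) (p_seq r rt q) = (0 :: 'a)"
      using assms(2) by (intro block_negative[of j]) (auto simp: p_seq_def p_ext_def)
    thus ?thesis by (simp add: Phi_coeff_block)
  next
    case (6 j)
    hence "block rt \<nu> (\<lambda>j. q (Xt j)) (\<lambda>j. q (Yt j)) (pt_seq r rt q) = (0 :: 'a)"
      using assms(2) by (intro block_negative[of j]) (auto simp: pt_seq_def pt_ext_def)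
    thus ?thesis by (simp add: Phi_coeff_block)
  qed (use assms(2) in \<open>simp_all add: Phi_coeff_block block_negative\<close>)
qed

lemma Phi_coeff_cong:
  assumes "\<And>j. j < r \<Longrightarrow> \<mu> j = \<mu>' j" "\<And>j. j < rt \<Longrightarrow> \<nu> j = \<nu>' j"
  shows "Phi_coeff r rt \<mu> \<nu> = Phi_coeff r rt \<mu>' \<nu>'"
  unfolding Phi_coeff_block using assms by (intro ext arg_cong2[where f = "(*)"] block_cong refl) auto

lemma sum_of_bool_single: "(j :: nat) < n \<Longrightarrow> (\<Sum>i<n. of_bool (i = j)) = (1 :: int)"
  by (simp add: of_bool_def sum.delta)

lemma minus_one_powi_diff_1: "(-1 :: 'a :: field) powi (n - 1) = - ((-1) powi n)"
  by (subst power_int_diff) auto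

text \<open>This is \<open>block_step\<close> for the first block. Lowering the exponent of
  \<open>X j\<close> also lowers \<open>p_{-1}\<close>, and that of \<open>Y j\<close> lowers
  \<open>pt_{-1}\<close>; the shift by \<open>unit_vec 0\<close> in \<mu> or \<nu> absorbs this by
  \<open>block_decrement_0\<close>. Both flip the sign.\<close>

lemma Phi_coeff_step:
  assumes j: "j < r"
  shows "Phi_coeff r rt (\<mu> + unit_vec j) \<nu> q = Phi_coeff r rt \<mu> \<nu> q
     - Phi_coeff r rt (\<mu> + unit_vec j + unit_vec 0) \<nu> (decrement {X j} q)
     - Phi_coeff r rt (\<mu> + unit_vec j) (\<nu> + unit_vec 0) (decrement {Y j} q)
     + (if Suc j < r then Phi_coeff r rt (\<mu> + unit_vec j + unit_vec (Suc j)) \<nu> (decrement {Z j} q)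
        else (0 :: 'a :: field_char_0))"
proof -
  let ?B = "block r" and ?m = "\<lambda>j. q (X j)" and ?k = "\<lambda>j. q (Y j)" and ?p = "p_seq r rt q"
  let ?s = "(-1 :: 'a) powi total r rt q"
  let ?t = "block rt \<nu> (\<lambda>j. q (Xt j)) (\<lambda>j. q (Yt j)) (pt_seq r rt q) :: 'a"
  have X: "total r rt (decrement {X j} q) = total r rt q - 1"
      "p_seq r rt (decrement {X j} q) = p_seq r rt q - unit_vec 0"
      "pt_seq r rt (decrement {X j} q) = pt_seq r rt q"
      "(\<lambda>i. decrement {X j} q (X i)) = ?m - unit_vec j"
    using j by (auto simp: total_def p_seq_def pt_seq_def p_ext_def pt_ext_def decrement_def unit_vec_def
        sum_subtractf sum_of_bool_single fun_eq_iff)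
  have Y: "total r rt (decrement {Y j} q) = total r rt q - 1"
      "pt_seq r rt (decrement {Y j} q) = pt_seq r rt q - unit_vec 0"
      "p_seq r rt (decrement {Y j} q) = p_seq r rt q"
      "(\<lambda>i. decrement {Y j} q (Y i)) = ?k - unit_vec j"
    using j by (auto simp: total_def p_seq_def pt_seq_def p_ext_def pt_ext_def decrement_def unit_vec_def
        sum_subtractf sum_of_bool_single fun_eq_iff)
  have Z: "total r rt (decrement {Z j} q) = total r rt q"
      "pt_seq r rt (decrement {Z j} q) = pt_seq r rt q"
      "Suc j < r \<Longrightarrow> p_seq r rt (decrement {Z j} q) = p_seq r rt q - unit_vec (Suc j)"
    by (auto simp: total_def p_seq_def pt_seq_def p_ext_def pt_ext_def decrement_def unit_vec_def fun_eq_iff)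
  have e1: "Phi_coeff r rt (\<mu> + unit_vec j + unit_vec 0) \<nu> (decrement {X j} q)
      = - (?s * ?B (\<mu> + unit_vec j) (?m - unit_vec j) ?k ?p * ?t)"
    unfolding Phi_coeff_block X block_decrement_0
    by (simp add: minus_one_powi_diff_1) (simp add: decrement_def)
  have e2: "Phi_coeff r rt (\<mu> + unit_vec j) (\<nu> + unit_vec 0) (decrement {Y j} q)
      = - (?s * ?B (\<mu> + unit_vec j) ?m (?k - unit_vec j) ?p * ?t)"
    unfolding Phi_coeff_block Y block_decrement_0
    by (simp add: minus_one_powi_diff_1) (simp add: decrement_def)
  have e3: "(if Suc j < r
        then Phi_coeff r rt (\<mu> + unit_vec j + unit_vec (Suc j)) \<nu> (decrement {Z j} q) else 0)
      = ?s * ?B (\<mu> + unit_vec j + unit_vec (Suc j)) ?m ?k (?p - unit_vec (Suc j)) * ?t"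
  proof (cases "Suc j < r")
    case True
    thus ?thesis unfolding Phi_coeff_block Z(1,2) Z(3)[OF True] by (simp add: decrement_def)
  next
    case False
    \<comment> \<open>Here \<open>j\<close> is the last index: the fourth Pascal term lowers
      \<open>p_{r-1} = 0\<close> to -1 and vanishes.\<close>
    hence "?B (\<mu> + unit_vec j + unit_vec (Suc j)) ?m ?k (?p - unit_vec (Suc j)) = (0 :: 'a)"
      using j by (intro block_negative[of j]) (auto simp: p_seq_def p_ext_def unit_vec_def)
    with False show ?thesis by simp
  qed
  show ?thesis
    unfolding e1 e2 e3 Phi_coeff_block[of r rt "\<mu> + unit_vec j" \<nu> q]
      Phi_coeff_block[of r rt \<mu> \<nu> q] block_step[OF j, of \<mu> ?m ?k ?p]
    by (simp only: ring_distribs mult_minus_left diff_minus_eq_add ac_simps)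
qed

text \<open>This exchange also swaps \<open>p_{-1}\<close> with \<open>pt_{-1}\<close>, so the tilde
  recurrence follows from the first one by symmetry.\<close>

fun swap_tilde :: "var \<Rightarrow> var" where
  "swap_tilde (X i) = Xt i" | "swap_tilde (Y i) = Yt i" | "swap_tilde (Z i) = Zt i"
| "swap_tilde (Xt i) = X i" | "swap_tilde (Yt i) = Y i" | "swap_tilde (Zt i) = Z i"

lemma Phi_coeff_swap: "Phi_coeff rt r \<nu> \<mu> (q \<circ> swap_tilde) = Phi_coeff r rt \<mu> \<nu> q"
proof -
  have "p_seq rt r (q \<circ> swap_tilde) = pt_seq r rt q" "pt_seq rt r (q \<circ> swap_tilde) = p_seq r rt q"
    by (auto simp: p_seq_def pt_seq_def p_ext_def pt_ext_def fun_eq_iff)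
  thus ?thesis by (simp add: Phi_coeff_block total_def ac_simps)
qed

lemma decrement_swap: "decrement {v} (q \<circ> swap_tilde) = decrement {swap_tilde v} q \<circ> swap_tilde"
  by (auto simp: decrement_def fun_eq_iff elim: swap_tilde.elims)

lemma Phi_coeff_step_tilde:
  assumes j: "j < rt"
  shows "Phi_coeff r rt \<mu> (\<nu> + unit_vec j) q = Phi_coeff r rt \<mu> \<nu> q
     - Phi_coeff r rt \<mu> (\<nu> + unit_vec j + unit_vec 0) (decrement {Xt j} q)
     - Phi_coeff r rt (\<mu> + unit_vec 0) (\<nu> + unit_vec j) (decrement {Yt j} q)
     + (if Suc j < rt then Phi_coeff r rt \<mu> (\<nu> + unit_vec j + unit_vec (Suc j)) (decrement {Zt j} q)
        else (0 :: 'a :: field_char_0))"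
  using Phi_coeff_step[OF j, of r \<nu> \<mu> "q \<circ> swap_tilde", where 'a = 'a]
  unfolding decrement_swap Phi_coeff_swap by simp

lemma half_rec_Phi:
  "half_rec r X Y Z (Phi r rt)" "half_rec rt Xt Yt Zt (\<lambda>\<nu> \<mu>. Phi r rt \<mu> \<nu>)"
proof -
  have mult: "indet v * series_of (vars r rt) (Phi_coeff r rt \<mu> \<nu>) = series_of (vars r rt) (\<lambda>q. Phi_coeff r rt \<mu> \<nu> (decrement {v} q))"
    if "v \<in> vars r rt" for v \<mu> \<nu>
    using that by (intro indet_mult_series_of Phi_coeff_negative) auto
  show "half_rec r X Y Z (Phi r rt)"
    unfolding half_rec_def
  proof (intro allI impI mps_eqI)
    fix \<mu> \<nu> j q assume j: "j < r"
    hence "X j \<in> vars r rt" "Y j \<in> vars r rt" "Suc j < r \<Longrightarrow> Z j \<in> vars r rt"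
      by (auto simp: vars_def)
    note m = this[THEN mult]
    show "mcoeff (Phi r rt (\<mu> + unit_vec j) \<nu>) q = mcoeff (Phi r rt \<mu> \<nu>
        - indet (X j) * Phi r rt (\<mu> + unit_vec j + unit_vec 0) \<nu>
        - indet (Y j) * Phi r rt (\<mu> + unit_vec j) (\<nu> + unit_vec 0)
        + (if Suc j < r then indet (Z j) * Phi r rt (\<mu> + unit_vec j + unit_vec (Suc j)) \<nu> else 0)) q"
      unfolding Phi_series_of m(1,2)
      by (cases "Suc j < r") (simp_all add: m(3) mcoeff_series_of 
          Phi_coeff_step[OF j, of rt \<mu> \<nu> "\<lambda>v. int (Poly_Mapping.lookup q v)"])
  qed
  show "half_rec rt Xt Yt Zt (\<lambda>\<nu> \<mu>. Phi r rt \<mu> \<nu>)"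
    unfolding half_rec_def
  proof (intro allI impI mps_eqI)
    fix \<nu> \<mu> j q assume j: "j < rt"
    hence "Xt j \<in> vars r rt" "Yt j \<in> vars r rt" "Suc j < rt \<Longrightarrow> Zt j \<in> vars r rt"
      by (auto simp: vars_def)
    note m = this[THEN mult]
    show "mcoeff (Phi r rt \<mu> (\<nu> + unit_vec j)) q = mcoeff (Phi r rt \<mu> \<nu>
        - indet (Xt j) * Phi r rt \<mu> (\<nu> + unit_vec j + unit_vec 0)
        - indet (Yt j) * Phi r rt (\<mu> + unit_vec 0) (\<nu> + unit_vec j)
        + (if Suc j < rt then indet (Zt j) * Phi r rt \<mu> (\<nu> + unit_vec j + unit_vec (Suc j)) else 0)) q"
      unfolding Phi_series_of m(1,2)
      by (cases "Suc j < rt") (simp_all add: m(3) mcoeff_series_of 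
          Phi_coeff_step_tilde[OF j, of r \<mu> \<nu> "\<lambda>v. int (Poly_Mapping.lookup q v)"])
  qed
qed


section \<open>The value of the expansion at the origin\<close>

text \<open>The monomials are squarefree, hence given by sets of labels, and multiplication by one
  of them becomes a single \<open>decrement\<close>.\<close>

definition chain_set :: "(nat \<Rightarrow> var) \<Rightarrow> (nat \<Rightarrow> var) \<Rightarrow> int \<Rightarrow> var set" where
  "chain_set U V i = (if i = -1 then {} else insert (U (nat i)) (V ` {..<nat i}))"

lemma finite_chain_set [simp]: "finite (chain_set U V i)"
  by (simp add: chain_set_def)

lemma mem_chain_set:
  assumes "i \<ge> -1"
  shows "v \<in> chain_set U V i \<longleftrightarrow> (\<exists>j. v = U j \<and> int j = i) \<or> (\<exists>j. v = V j \<and> int j < i)"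
proof (cases "i = -1")
  case False
  hence "i \<ge> 0" using assms by simp
  then obtain l where "i = int l" by (rule nonneg_int_cases)
  thus ?thesis by (auto simp: chain_set_def)
qed (simp add: chain_set_def)

lemma chain_eq_prod:
  assumes "inj V" "\<And>j l. U j \<noteq> V l"
  shows "chain U V i = prod indet (chain_set U V i)"
proof (cases "i = -1")
  case False
  have "U (nat i) \<notin> V ` {..<nat i}" using assms(2) by blast
  with False show ?thesis
    using assms(1) by (simp add: chain_def chain_set_def prod.reindex inj_on_subset)
qed (simp add: chain_def chain_set_def)

lemma mcoeff_chain_mult_Phi:
  assumes U: "U = X \<and> Ut = Xt \<or> U = Y \<and> Ut = Yt"
    and i: "i \<in> {-1..int r - 1}" and k: "k \<in> {-1..int rt - 1}"
  shows "mcoeff (chain U Z i * chain Ut Zt k * Phi r rt \<mu> \<nu>) q =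
    (if Poly_Mapping.keys q \<subseteq> vars r rt
     then Phi_coeff r rt \<mu> \<nu> (decrement (chain_set U Z i \<union> chain_set Ut Zt k)
       (\<lambda>v. int (Poly_Mapping.lookup q v))) else 0)"
proof -
  have "chain U Z i = (prod indet (chain_set U Z i) :: (var, 'a) mps)"
       "chain Ut Zt k = (prod indet (chain_set Ut Zt k) :: (var, 'a) mps)"
    using U by (intro chain_eq_prod; auto simp: inj_on_def)+
  moreover have "chain_set U Z i \<inter> chain_set Ut Zt k = {}"
    using i k U by (auto simp: mem_chain_set)
  ultimately have "chain U Z i * chain Ut Zt k
      = (prod indet (chain_set U Z i \<union> chain_set Ut Zt k) :: (var, 'a) mps)"
    by (simp add: prod.union_disjoint)
  moreover have "chain_set U Z i \<union> chain_set Ut Zt k \<subseteq> vars r rt"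
    using i k U by (auto simp: mem_chain_set vars_def)
  ultimately show ?thesis
    by (simp add: Phi_series_of prod_indet_mult_series_of Phi_coeff_negative mcoeff_series_of)
qed

definition shifted_block :: "nat \<Rightarrow> int \<Rightarrow> (nat \<Rightarrow> int) \<Rightarrow> (nat \<Rightarrow> int) \<Rightarrow> (nat \<Rightarrow> int)
    \<Rightarrow> (nat \<Rightarrow> int) \<Rightarrow> 'a :: field_char_0" where
  "shifted_block n i a m k p = (\<Prod>j<n. trinom (a j) (m j) (k j) (p (Suc j) - of_bool (int j < i)))"

text \<open>For \<open>j \<le> i\<close> the lowered entries take exactly 2 from the upper argument:
  through \<open>m j\<close> and \<open>p j\<close> if \<open>j = i\<close>, through
  \<open>p j\<close> and \<open>p (Suc j)\<close> if \<open>j < i\<close>. This is what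
  \<open>nu i j\<close> restores.\<close>

lemma block_nu_m:
  "block n (nu i) (\<lambda>j. m j - of_bool (int j = i)) k (\<lambda>j. p j - of_bool (int j \<le> i))
     = shifted_block n i (block_arg m k p) (\<lambda>j. m j - of_bool (int j = i)) k p"
  unfolding block_def shifted_block_def
  by (intro prod.cong refl arg_cong[where f = "\<lambda>a. trinom a _ _ _"] arg_cong2[where f = "\<lambda>a p. trinom a _ _ p"])
     (auto simp: block_arg_def nu_def sigma_def)

lemma block_nu_k:
  "block n (nu i) m (\<lambda>j. k j - of_bool (int j = i)) (\<lambda>j. p j - of_bool (int j \<le> i))
     = shifted_block n i (block_arg m k p) m (\<lambda>j. k j - of_bool (int j = i)) p"
  unfolding block_def shifted_block_def
  by (intro prod.cong refl arg_cong[where f = "\<lambda>a. trinom a _ _ _"] arg_cong2[where f = "\<lambda>a p. trinom a _ _ p"])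
     (auto simp: block_arg_def nu_def sigma_def)

lemma sum_of_bool_int: "i < int n \<Longrightarrow> (\<Sum>j<n. of_bool (int j = i)) = (of_bool (0 \<le> i) :: int)"
proof (cases "0 \<le> i")
  case True
  assume "i < int n"
  moreover have "int j = i \<longleftrightarrow> j = nat i" for j using True by auto
  ultimately show ?thesis using True sum_of_bool_single[of "nat i" n] by simp
qed auto

text \<open>Lowering the exponent of \<open>X i\<close> lowers \<open>p_{-1}\<close> too, so
  \<open>p_seq\<close> is lowered at all \<open>j \<le> i\<close>, as \<open>block_nu_m\<close>
  requires. Each half with a nonempty chain flips the sign once.\<close>

lemma Phi_coeff_chain_X:
  assumes i: "i \<in> {-1..int r - 1}" and k: "k \<in> {-1..int rt - 1}"
  shows "Phi_coeff r rt (nu i) (nu k) (decrement (chain_set X Z i \<union> chain_set Xt Zt k) q) =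
    (-1) powi total r rt q
    * ((if i = -1 then 1 else -1) * shifted_block r i (block_arg (\<lambda>j. q (X j)) (\<lambda>j. q (Y j)) (p_seq r rt q))
         (\<lambda>j. q (X j) - of_bool (int j = i)) (\<lambda>j. q (Y j)) (p_seq r rt q))
    * ((if k = -1 then 1 else -1) * shifted_block rt k (block_arg (\<lambda>j. q (Xt j)) (\<lambda>j. q (Yt j)) (pt_seq r rt q))
         (\<lambda>j. q (Xt j) - of_bool (int j = k)) (\<lambda>j. q (Yt j)) (pt_seq r rt q) :: 'a :: field_char_0)"
proof -
  let ?S = "chain_set X Z i \<union> chain_set Xt Zt k"
  have ik: "i \<ge> -1" "k \<ge> -1" "i < int r" "k < int rt" using i k by auto
  have d: "decrement ?S q (X j) = q (X j) - of_bool (int j = i)" "decrement ?S q (Y j) = q (Y j)"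
    "decrement ?S q (Z j) = q (Z j) - of_bool (int j < i)"
    "decrement ?S q (Xt j) = q (Xt j) - of_bool (int j = k)" "decrement ?S q (Yt j) = q (Yt j)"
    "decrement ?S q (Zt j) = q (Zt j) - of_bool (int j < k)" for j
    using ik by (auto simp: decrement_def mem_chain_set)
  have tot: "total r rt (decrement ?S q) = total r rt q - of_bool (0 \<le> i) - of_bool (0 \<le> k)"
    using ik by (simp add: total_def d sum_subtractf sum_of_bool_int del: sum_of_bool_eq)
  have "block r (nu i) (\<lambda>j. decrement ?S q (X j)) (\<lambda>j. decrement ?S q (Y j)) (p_seq r rt (decrement ?S q))
      = (block r (nu i) (\<lambda>j. q (X j) - of_bool (int j = i)) (\<lambda>j. q (Y j))
           (\<lambda>j. p_seq r rt q j - of_bool (int j \<le> i)) :: 'a)"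
    by (rule block_cong) (use ik in \<open>auto simp: d p_seq_def p_ext_def sum_subtractf sum_of_bool_int simp del: sum_of_bool_eq\<close>)
  moreover have "block rt (nu k) (\<lambda>j. decrement ?S q (Xt j)) (\<lambda>j. decrement ?S q (Yt j)) (pt_seq r rt (decrement ?S q))
      = (block rt (nu k) (\<lambda>j. q (Xt j) - of_bool (int j = k)) (\<lambda>j. q (Yt j))
           (\<lambda>j. pt_seq r rt q j - of_bool (int j \<le> k)) :: 'a)"
    by (rule block_cong) (use ik in \<open>auto simp: d pt_seq_def pt_ext_def sum_subtractf sum_of_bool_int simp del: sum_of_bool_eq\<close>)
  moreover have "(-1 :: 'a) powi total r rt (decrement ?S q)
      = (-1) powi total r rt q * (if i = -1 then 1 else -1) * (if k = -1 then 1 else -1)"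
    unfolding tot using ik by (auto simp: minus_one_powi_diff_1)
  ultimately show ?thesis
    unfolding Phi_coeff_block block_nu_m by simp
qed

text \<open>Here \<open>Y i\<close> lowers \<open>pt_{-1}\<close> and \<open>Yt k\<close> lowers
  \<open>p_{-1}\<close>: each half owes the lowering at index 0 to the other, so both chains have to
  be nonempty. The two sign changes cancel.\<close>

lemma Phi_coeff_chain_Y:
  assumes i: "i \<in> {0..int r - 1}" and k: "k \<in> {0..int rt - 1}"
  shows "Phi_coeff r rt (nu i) (nu k) (decrement (chain_set Y Z i \<union> chain_set Yt Zt k) q) =
    (-1) powi total r rt q
    * shifted_block r i (block_arg (\<lambda>j. q (X j)) (\<lambda>j. q (Y j)) (p_seq r rt q))
         (\<lambda>j. q (X j)) (\<lambda>j. q (Y j) - of_bool (int j = i)) (p_seq r rt q)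
    * (shifted_block rt k (block_arg (\<lambda>j. q (Xt j)) (\<lambda>j. q (Yt j)) (pt_seq r rt q))
         (\<lambda>j. q (Xt j)) (\<lambda>j. q (Yt j) - of_bool (int j = k)) (pt_seq r rt q) :: 'a :: field_char_0)"
proof -
  let ?S = "chain_set Y Z i \<union> chain_set Yt Zt k"
  have ik: "i \<ge> -1" "k \<ge> -1" "i \<ge> 0" "k \<ge> 0" "i < int r" "k < int rt" using i k by auto
  have d: "decrement ?S q (Y j) = q (Y j) - of_bool (int j = i)" "decrement ?S q (X j) = q (X j)"
    "decrement ?S q (Z j) = q (Z j) - of_bool (int j < i)"
    "decrement ?S q (Yt j) = q (Yt j) - of_bool (int j = k)" "decrement ?S q (Xt j) = q (Xt j)"
    "decrement ?S q (Zt j) = q (Zt j) - of_bool (int j < k)" for j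
    using ik by (auto simp: decrement_def mem_chain_set)
  have tot: "total r rt (decrement ?S q) = total r rt q - 1 - 1"
    using ik by (simp add: total_def d sum_subtractf sum_of_bool_int del: sum_of_bool_eq)
  have "block r (nu i) (\<lambda>j. decrement ?S q (X j)) (\<lambda>j. decrement ?S q (Y j)) (p_seq r rt (decrement ?S q))
      = (block r (nu i) (\<lambda>j. q (X j)) (\<lambda>j. q (Y j) - of_bool (int j = i))
           (\<lambda>j. p_seq r rt q j - of_bool (int j \<le> i)) :: 'a)"
    by (rule block_cong) (use ik in \<open>auto simp: d p_seq_def p_ext_def sum_subtractf sum_of_bool_int simp del: sum_of_bool_eq\<close>)
  moreover have "block rt (nu k) (\<lambda>j. decrement ?S q (Xt j)) (\<lambda>j. decrement ?S q (Yt j)) (pt_seq r rt (decrement ?S q))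
      = (block rt (nu k) (\<lambda>j. q (Xt j)) (\<lambda>j. q (Yt j) - of_bool (int j = k))
           (\<lambda>j. pt_seq r rt q j - of_bool (int j \<le> k)) :: 'a)"
    by (rule block_cong) (use ik in \<open>auto simp: d pt_seq_def pt_ext_def sum_subtractf sum_of_bool_int simp del: sum_of_bool_eq\<close>)
  moreover have "(-1 :: 'a) powi total r rt (decrement ?S q) = (-1) powi total r rt q"
    unfolding tot by (simp only: minus_one_powi_diff_1 minus_minus)
  ultimately show ?thesis
    unfolding Phi_coeff_block block_nu_k by simp
qed

lemma sum_int_atLeast_0: "(\<Sum>i\<in>{0..int n - 1}. f i) = (\<Sum>i<n. f (int i))"
  by (rule sum.reindex_bij_witness[of _ int nat]) auto

lemma sum_int_atLeast_minus_1: "(\<Sum>i\<in>{-1..int n - 1}. f i) = f (-1) + (\<Sum>i<n. f (int i))"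
proof -
  have "{-1..int n - 1} = insert (-1) {0..int n - 1}" by auto
  thus ?thesis by (simp add: sum_int_atLeast_0)
qed

lemma sum_shifted_block_m:
  "(\<Sum>i\<in>{-1..int n - 1}. (if i = -1 then 1 else -1)
      * shifted_block n i (block_arg m k p) (\<lambda>j. m j - of_bool (int j = i)) k p)
    = block n 0 m k p - block_sum_m n m k p"
  by (simp add: sum_int_atLeast_minus_1 shifted_block_def block_def block_sum_m_def block_arg_def sum_negf)

lemma sum_shifted_block_k:
  "(\<Sum>i\<in>{0..int n - 1}. shifted_block n i (block_arg m k p) m (\<lambda>j. k j - of_bool (int j = i)) p)
    = block_sum_k n m k p"
  by (simp add: sum_int_atLeast_0 shifted_block_def block_sum_k_def)

text \<open>The bracket of the theorem with free exponent vectors in place of \<open>pi_vec\<close>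
  and \<open>pit_vec\<close>, so that the recurrences apply.\<close>

definition expansion :: "nat \<Rightarrow> nat \<Rightarrow> (nat \<Rightarrow> int) \<Rightarrow> (nat \<Rightarrow> int) \<Rightarrow> (var, 'a :: field_char_0) mps" where
  "expansion r rt \<mu> \<nu> =
    (\<Sum>i\<in>{-1..int r - 1}. \<Sum>k\<in>{-1..int rt - 1}.
       chain X Z i * chain Xt Zt k * Phi r rt (\<mu> + nu i) (\<nu> + nu k))
    - (\<Sum>i\<in>{0..int r - 1}. \<Sum>k\<in>{0..int rt - 1}.
       chain Y Z i * chain Yt Zt k * Phi r rt (\<mu> + nu i) (\<nu> + nu k))"

text \<open>At the origin every summand is a term in \<open>i\<close> times a term in the other
  index, so each double sum is a product of one sum per half.\<close>

lemma mcoeff_expansion_0: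
  assumes "Poly_Mapping.keys q \<subseteq> vars r rt"
  defines "m \<equiv> \<lambda>j. int (Poly_Mapping.lookup q (X j))" and "k \<equiv> \<lambda>j. int (Poly_Mapping.lookup q (Y j))"
    and "p \<equiv> p_seq r rt (\<lambda>v. int (Poly_Mapping.lookup q v))"
    and "mt \<equiv> \<lambda>j. int (Poly_Mapping.lookup q (Xt j))" and "kt \<equiv> \<lambda>j. int (Poly_Mapping.lookup q (Yt j))"
    and "pt \<equiv> pt_seq r rt (\<lambda>v. int (Poly_Mapping.lookup q v))"
  shows "mcoeff (expansion r rt 0 0 :: (var, 'a :: field_char_0) mps) q =
    (-1) powi total r rt (\<lambda>v. int (Poly_Mapping.lookup q v))
    * ((block r 0 m k p - block_sum_m r m k p) * (block rt 0 mt kt pt - block_sum_m rt mt kt pt)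
       - block_sum_k r m k p * block_sum_k rt mt kt pt)"
proof -
  let ?q = "\<lambda>v. int (Poly_Mapping.lookup q v)"
  let ?s = "(-1 :: 'a) powi total r rt ?q"
  let ?f = "\<lambda>n m k p i. (if i = -1 then 1 else -1)
    * shifted_block n i (block_arg m k p) (\<lambda>j. m j - of_bool (int j = i)) k p :: 'a"
  let ?g = "\<lambda>n m k p i. shifted_block n i (block_arg m k p) m (\<lambda>j. k j - of_bool (int j = i)) p :: 'a"
  have "mcoeff (expansion r rt 0 0) q =
      (\<Sum>i\<in>{-1..int r - 1}. \<Sum>l\<in>{-1..int rt - 1}.
         Phi_coeff r rt (nu i) (nu l) (decrement (chain_set X Z i \<union> chain_set Xt Zt l) ?q))
      - (\<Sum>i\<in>{0..int r - 1}. \<Sum>l\<in>{0..int rt - 1}.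
         Phi_coeff r rt (nu i) (nu l) (decrement (chain_set Y Z i \<union> chain_set Yt Zt l) ?q) :: 'a)"
    unfolding expansion_def mcoeff_simps mcoeff_sum
    by (intro arg_cong2[where f = "(-)"] sum.cong refl; subst mcoeff_chain_mult_Phi) (use assms(1) in auto)
  also have "\<dots> = (\<Sum>i\<in>{-1..int r - 1}. \<Sum>l\<in>{-1..int rt - 1}. ?s * ?f r m k p i * ?f rt mt kt pt l)
      - (\<Sum>i\<in>{0..int r - 1}. \<Sum>l\<in>{0..int rt - 1}. ?s * ?g r m k p i * ?g rt mt kt pt l)"
    unfolding m_def k_def p_def mt_def kt_def pt_def
    by (intro arg_cong2[where f = "(-)"] sum.cong refl Phi_coeff_chain_X Phi_coeff_chain_Y)
  also have "\<dots> = ?s * ((\<Sum>i\<in>{-1..int r - 1}. ?f r m k p i) * (\<Sum>l\<in>{-1..int rt - 1}. ?f rt mt kt pt l)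
      - (\<Sum>i\<in>{0..int r - 1}. ?g r m k p i) * (\<Sum>l\<in>{0..int rt - 1}. ?g rt mt kt pt l))"
    unfolding right_diff_distrib sum_product unfolding sum_distrib_left by (simp only: mult.assoc)
  finally show ?thesis unfolding sum_shifted_block_m sum_shifted_block_k .
qed

lemma expansion_0:
  assumes "r \<ge> 1" "rt \<ge> 1"
  shows "expansion r rt 0 0 = (1 :: (var, 'a :: field_char_0) mps)"
proof (rule mps_eqI)
  fix q :: "var \<Rightarrow>\<^sub>0 nat"
  show "mcoeff (expansion r rt 0 0) q = mcoeff (1 :: (var, 'a) mps) q"
  proof (cases "Poly_Mapping.keys q \<subseteq> vars r rt")
    case False
    hence "q \<noteq> 0" by auto
    moreover have "mcoeff (expansion r rt 0 0 :: (var, 'a) mps) q = 0"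
      unfolding expansion_def mcoeff_simps mcoeff_sum using False
      by (simp add: mcoeff_chain_mult_Phi)
    ultimately show ?thesis by simp
  next
    case True
    define m k p where "m = (\<lambda>j. int (Poly_Mapping.lookup q (X j)))"
      and "k = (\<lambda>j. int (Poly_Mapping.lookup q (Y j)))"
      and "p = p_seq r rt (\<lambda>v. int (Poly_Mapping.lookup q v))"
    define mt kt pt where "mt = (\<lambda>j. int (Poly_Mapping.lookup q (Xt j)))"
      and "kt = (\<lambda>j. int (Poly_Mapping.lookup q (Yt j)))"
      and "pt = pt_seq r rt (\<lambda>v. int (Poly_Mapping.lookup q v))"
    note defs = m_def k_def p_def mt_def kt_def pt_def
    note coeff = mcoeff_expansion_0[OF True, where 'a = 'a, folded defs]
    have p0: "p 0 = (\<Sum>j<r. m j) + (\<Sum>j<rt. kt j)" "pt 0 = (\<Sum>j<rt. mt j) + (\<Sum>j<r. k j)"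
      by (simp_all add: defs p_seq_def pt_seq_def p_ext_def pt_ext_def)
    have nonneg: "m j \<ge> 0" "k j \<ge> 0" "p j \<ge> 0" "mt j \<ge> 0" "kt j \<ge> 0" "pt j \<ge> 0" for j
      by (simp_all add: defs p_seq_def pt_seq_def p_ext_def pt_ext_def sum_nonneg)
    have last: "p r = 0" "pt rt = 0"
      using assms by (simp_all add: defs p_seq_def pt_seq_def p_ext_def pt_ext_def)
    have p_Suc: "p (Suc j) = int (Poly_Mapping.lookup q (Z j))" if "Suc j < r" for j
      using that by (simp add: defs p_seq_def p_ext_def)
    have pt_Suc: "pt (Suc j) = int (Poly_Mapping.lookup q (Zt j))" if "Suc j < rt" for j
      using that by (simp add: defs pt_seq_def pt_ext_def)
    have q0: "block r 0 m k p = (1 :: 'a)" "block rt 0 mt kt pt = (1 :: 'a)" "p 0 = 0" "pt 0 = 0" if "q = 0"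
      using that by (simp_all add: block_def defs p_seq_def pt_seq_def p_ext_def pt_ext_def)
    show ?thesis
    proof (cases rule: block_sums[of r m k p, where 'a = 'a, case_names nonneg1 nonneg2 nonneg3 last factor zero])
      case (factor K)
      \<comment> \<open>For \<open>q = 0\<close> the block is 1 while \<open>p 0 = 0\<close>, which
        contradicts the factorization.\<close>
      hence "q \<noteq> 0" using q0(1,3) by auto
      show ?thesis
      proof (cases rule: block_sums[of rt mt kt pt, where 'a = 'a, case_names nonneg1 nonneg2 nonneg3 last factor zero])
        case factor2: (factor Kt)
        show ?thesis unfolding coeff factor factor2 p0 using \<open>q \<noteq> 0\<close> by (simp add: algebra_simps)
      next
        case zero
        \<comment> \<open>The tilde half contributes 1 and 0, so \<open>K\<close> is multiplied by
          \<open>p 0\<close> minus the sum of \<open>m\<close>, which is the sum of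
          \<open>kt\<close>.\<close>
        hence "(\<Sum>j<rt. kt j) = 0" by simp
        thus ?thesis unfolding coeff factor zero p0 using \<open>q \<noteq> 0\<close> by simp
      qed (use nonneg last in auto)
    next
      case zero
      show ?thesis
      proof (cases rule: block_sums[of rt mt kt pt, where 'a = 'a, case_names nonneg1 nonneg2 nonneg3 last factor zero])
        case (factor Kt)
        hence "q \<noteq> 0" using q0(2,4) by auto
        have "(\<Sum>j<r. k j) = 0" using zero by simp
        thus ?thesis unfolding coeff factor zero p0 using \<open>q \<noteq> 0\<close> by simp
      next
        case zero2: zero
        \<comment> \<open>In the remaining case all lower entries vanish, and they exhaust the
          exponents; so this is the constant term.\<close>
        have "Poly_Mapping.lookup q v = 0" if "v \<in> vars r rt" for v
        proof -
          have "p (Suc j) = 0" if "Suc j < r" for j using that zero(5) by auto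
          moreover have "pt (Suc j) = 0" if "Suc j < rt" for j using that zero2(5) by auto
          ultimately show ?thesis
            using that zero(4) zero2(4) p_Suc pt_Suc unfolding vars_def defs(1,2,4,5)
            by (auto simp: less_diff_conv)
        qed
        with True have "q = 0" by (metis in_keys_iff keys_eq_empty subsetD subsetI subset_empty)
        moreover from this have "total r rt (\<lambda>v. int (Poly_Mapping.lookup q v)) = 0"
          by (simp add: total_def)
        ultimately show ?thesis unfolding coeff zero zero2 by simp
      qed (use nonneg last in auto)
    qed (use nonneg last in auto)
  qed
qed


section \<open>Monomials in \<open>\<eta>\<close>\<close>

definition ratio :: "nat \<Rightarrow> (var \<Rightarrow> 'b :: field) \<Rightarrow> nat \<Rightarrow> 'b" where
  "ratio r e j = (1 + w_ext r e j) / (1 + e (X j) + e (Y j))"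

definition ratio_t :: "nat \<Rightarrow> (var \<Rightarrow> 'b :: field) \<Rightarrow> nat \<Rightarrow> 'b" where
  "ratio_t rt e j = (1 + wt_ext rt e j) / (1 + e (Xt j) + e (Yt j))"

lemma eta_factor_ratio:
  "eta_factor r rt e (X i) = ratio r e 0" "eta_factor r rt e (Y i) = ratio_t rt e 0"
  "eta_factor r rt e (Z i) = ratio r e i * ratio r e (Suc i)"
  "eta_factor r rt e (Xt i) = ratio_t rt e 0" "eta_factor r rt e (Yt i) = ratio r e 0"
  "eta_factor r rt e (Zt i) = ratio_t rt e i * ratio_t rt e (Suc i)"
  by (simp_all add: ratio_def ratio_t_def)

definition power_vec :: "nat \<Rightarrow> (nat \<Rightarrow> 'b :: field) \<Rightarrow> (nat \<Rightarrow> int) \<Rightarrow> 'b" where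
  "power_vec n R \<mu> = (\<Prod>j<n. R j powi \<mu> j)"

lemma power_vec_add_unit:
  assumes "j < n" "R j \<noteq> 0"
  shows "power_vec n R (\<mu> + unit_vec j) = power_vec n R \<mu> * R j"
proof -
  have "(\<Prod>i\<in>{..<n} - {j}. R i powi (\<mu> + unit_vec j) i) = (\<Prod>i\<in>{..<n} - {j}. R i powi \<mu> i)"
    by (intro prod.cong) (auto simp: unit_vec_def)
  thus ?thesis
    using assms unfolding power_vec_def
    by (simp add: prod.remove[of "{..<n}" j] unit_vec_def power_int_add)
qed

lemma power_vec_cong: "(\<And>j. j < n \<Longrightarrow> \<mu> j = \<mu>' j) \<Longrightarrow> power_vec n R \<mu> = power_vec n R \<mu>'"
  unfolding power_vec_def by (intro prod.cong) auto

text \<open>The factor \<open>R j * R (Suc j)\<close> of \<open>Z j\<close> spreads its exponent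
  over two neighbouring places, and \<open>R 0\<close> collects \<open>p_{-1}\<close>. This is the
  origin of \<open>pi_vec\<close>.\<close>

lemma power_vec_consecutive:
  assumes "\<And>j. j < Suc n \<Longrightarrow> R j \<noteq> 0" "p (Suc n) = 0"
  shows "power_vec (Suc n) R (\<lambda>j. p j + p (Suc j)) =
    R 0 powi p 0 * (\<Prod>j<n. (R j * R (Suc j)) powi p (Suc j))"
proof -
  have "power_vec (Suc n) R (\<lambda>j. p j + p (Suc j)) =
      (\<Prod>j<Suc n. R j powi p j) * (\<Prod>j<Suc n. R j powi p (Suc j))"
    unfolding power_vec_def prod.distrib[symmetric]
    by (intro prod.cong refl power_int_add) (use assms(1) in auto)
  also have "(\<Prod>j<Suc n. R j powi p j) = R 0 powi p 0 * (\<Prod>j<n. R (Suc j) powi p (Suc j))"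
    by (rule prod.lessThan_Suc_shift)
  also have "(\<Prod>j<Suc n. R j powi p (Suc j)) = (\<Prod>j<n. R j powi p (Suc j))"
    using assms(2) by simp
  finally show ?thesis by (simp add: power_int_mult_distrib prod.distrib ac_simps)
qed

lemma prod_power_int_const: "c \<noteq> 0 \<Longrightarrow> (\<Prod>i\<in>A. c powi f i) = (c :: 'b :: field) powi sum f A"
  by (induction A rule: infinite_finite_induct) (auto simp: power_int_add)

lemma prod_vars:
  "prod f (vars r rt) = (\<Prod>i<r. f (X i)) * (\<Prod>i<r. f (Y i)) * (\<Prod>i<r - 1. f (Z i))
     * (\<Prod>i<rt. f (Xt i)) * (\<Prod>i<rt. f (Yt i)) * (\<Prod>i<rt - 1. f (Zt i))"
proof -
  have "inj_on X A" "inj_on Y A" "inj_on Z A" "inj_on Xt A" "inj_on Yt A" "inj_on Zt A" for A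
    by (auto simp: inj_on_def)
  moreover have "U ` A \<inter> V ` B = {}" if "\<forall>i j. U i \<noteq> V j" for U V :: "nat \<Rightarrow> var" and A B
    using that by auto
  ultimately show ?thesis
    by (simp add: vars_def prod.union_disjoint prod.reindex Int_Un_distrib2)
qed

text \<open>The recurrence is \<open>rec\<close> times a power product, brought back to series by
  injectivity of \<open>to_fract\<close>.\<close>

lemma half_rec_power_vec:
  fixes E :: "(nat \<Rightarrow> int) \<Rightarrow> (nat \<Rightarrow> int) \<Rightarrow> ('v :: linorder, 'a :: field_char_0) mps"
  assumes E: "\<And>\<mu> \<nu>. to_fract (E \<mu> \<nu>) = power_vec r R \<mu> * power_vec rt S \<nu>"
    and nz: "\<And>j. j < r \<Longrightarrow> R j \<noteq> 0" "S 0 \<noteq> 0" and rt: "rt \<ge> 1"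
    and rec: "\<And>j. j < r \<Longrightarrow> R j = 1 - to_fract (indet (U j)) * R j * R 0 - to_fract (indet (V j)) * R j * S 0
      + (if Suc j < r then to_fract (indet (W j)) * R j * R (Suc j) else 0)"
  shows "half_rec r U V W E"
  unfolding half_rec_def
proof (intro allI impI)
  fix \<mu> \<nu> j assume j: "j < r"
  let ?d = "if Suc j < r then indet (W j) * E (\<mu> + unit_vec j + unit_vec (Suc j)) \<nu> else 0"
  let ?P = "power_vec r R \<mu>" and ?Q = "power_vec rt S \<nu>"
  have \<mu>: "power_vec r R (\<mu> + unit_vec j) = ?P * R j"
    "power_vec r R (\<mu> + unit_vec j + unit_vec 0) = ?P * R j * R 0"
    using j nz by (simp_all add: power_vec_add_unit)
  have \<nu>: "power_vec rt S (\<nu> + unit_vec 0) = ?Q * S 0"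
    using rt nz by (simp add: power_vec_add_unit)
  have d: "to_fract ?d = ?P * ?Q * (if Suc j < r then to_fract (indet (W j)) * R j * R (Suc j) else 0)"
    using j nz by (simp add: E \<mu> power_vec_add_unit[of "Suc j"])
  have "to_fract (E (\<mu> + unit_vec j) \<nu>) = ?P * ?Q * R j"
    by (simp add: E \<mu>)
  also have "\<dots> = ?P * ?Q * (1 - to_fract (indet (U j)) * R j * R 0 - to_fract (indet (V j)) * R j * S 0
      + (if Suc j < r then to_fract (indet (W j)) * R j * R (Suc j) else 0))"
    using rec[OF j] by simp
  also have "\<dots> = to_fract (E \<mu> \<nu> - indet (U j) * E (\<mu> + unit_vec j + unit_vec 0) \<nu>
     - indet (V j) * E (\<mu> + unit_vec j) (\<nu> + unit_vec 0) + ?d)"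
    unfolding to_fract_add to_fract_diff to_fract_mult d E \<mu> \<nu> by (simp only: algebra_simps mult_1_left mult_1_right)
  finally show "E (\<mu> + unit_vec j) \<nu> = E \<mu> \<nu> - indet (U j) * E (\<mu> + unit_vec j + unit_vec 0) \<nu>
     - indet (V j) * E (\<mu> + unit_vec j) (\<nu> + unit_vec 0) + ?d"
    by (simp only: to_fract_eq_iff)
qed

text \<open>The expansion combines translates of \<open>Phi\<close> with coefficients, the chains,
  that do not depend on \<mu> and \<nu>.\<close>

lemma half_rec_expansion:
  "half_rec r X Y Z (expansion r rt)" "half_rec rt Xt Yt Zt (\<lambda>\<nu> \<mu>. expansion r rt \<mu> \<nu>)"
  unfolding expansion_def
  by (intro half_rec_diff half_rec_sum half_rec_cmult half_rec_shift half_rec_Phi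
      half_rec_shift[of _ _ _ _ "\<lambda>\<nu> \<mu>. Phi r rt \<mu> \<nu>"])+

section \<open>From the equations for \<open>eta\<close> to the recurrences\<close>

text \<open>The equations read \<open>s_j = x_j R_0\<close>, \<open>t_j = y_j S_0\<close> and
  \<open>w_j = z_j R_j R_{j+1}\<close>; substituted into
  \<open>R_j (1 + s_j + t_j) = 1 + w_j\<close> they give the recurrence. Numerators and denominators
  are unit series since \<open>eta\<close> has no constant terms.\<close>

lemma is_eta_ratio:
  fixes eta :: "var \<Rightarrow> (var, 'a :: field_char_0) mps"
  assumes "is_eta r rt eta"
  defines "R \<equiv> ratio r (\<lambda>u. to_fract (eta u))" and "S \<equiv> ratio_t rt (\<lambda>u. to_fract (eta u))"
  shows is_eta_eq: "v \<in> vars r rt \<Longrightarrow>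
      to_fract (eta v) = to_fract (indet v) * eta_factor r rt (\<lambda>u. to_fract (eta u)) v"
    and ratio_unit: "j < r \<Longrightarrow> R j \<in> unit_series"
    and ratio_t_unit: "j < rt \<Longrightarrow> S j \<in> unit_series"
    and ratio_rec: "j < r \<Longrightarrow> R j = 1 - to_fract (indet (X j)) * R j * R 0 - to_fract (indet (Y j)) * R j * S 0
      + (if Suc j < r then to_fract (indet (Z j)) * R j * R (Suc j) else 0)"
    and ratio_t_rec: "j < rt \<Longrightarrow> S j = 1 - to_fract (indet (Xt j)) * S j * S 0 - to_fract (indet (Yt j)) * S j * R 0
      + (if Suc j < rt then to_fract (indet (Zt j)) * S j * S (Suc j) else 0)"
proof -
  let ?e = "\<lambda>u. to_fract (eta u)"
  have eq: "?e v = to_fract (indet v) * eta_factor r rt ?e v" if "v \<in> vars r rt" for v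
  proof -
    have "to_fract (indet v) = ?e v / eta_factor r rt ?e v"
      using assms(1) that by (simp add: is_eta_def)
    moreover have "indet v \<noteq> (0 :: (var, 'a) mps)"
    proof
      assume "indet v = (0 :: (var, 'a) mps)"
      hence "mcoeff (indet v :: (var, 'a) mps) (Poly_Mapping.single v 1) = 0" by simp
      thus False by (simp add: indet_def)
    qed
    \<comment> \<open>Division by 0 yields 0, so a vanishing factor would make the indeterminate
      0.\<close>
    ultimately show ?thesis by (cases "eta_factor r rt ?e v = 0") auto
  qed
  thus "v \<in> vars r rt \<Longrightarrow> ?e v = to_fract (indet v) * eta_factor r rt ?e v" .
  have mem: "j < r \<Longrightarrow> X j \<in> vars r rt" "j < r \<Longrightarrow> Y j \<in> vars r rt" "Suc j < r \<Longrightarrow> Z j \<in> vars r rt"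
    "j < rt \<Longrightarrow> Xt j \<in> vars r rt" "j < rt \<Longrightarrow> Yt j \<in> vars r rt" "Suc j < rt \<Longrightarrow> Zt j \<in> vars r rt" for j
    by (auto simp: vars_def)
  have const: "mcoeff (eta v) 0 = 0" if "v \<in> vars r rt" for v
    using assms(1) that by (simp add: is_eta_def)
  have unit1: "1 + ?e v \<in> unit_series" if "v \<in> vars r rt" for v
    unfolding unit_series_def using const[OF that]
    by (intro image_eqI[of _ _ "1 + eta v"]) simp_all
  have unit2: "1 + ?e u + ?e v \<in> unit_series" if "u \<in> vars r rt" "v \<in> vars r rt" for u v
    unfolding unit_series_def using that[THEN const]
    by (intro image_eqI[of _ _ "1 + eta u + eta v"]) simp_all
  have w: "w_ext r ?e j = (if Suc j < r then ?e (Z j) else 0)" if "j < r" for j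
    using that by (auto simp: w_ext_def)
  have wt: "wt_ext rt ?e j = (if Suc j < rt then ?e (Zt j) else 0)" if "j < rt" for j
    using that by (auto simp: wt_ext_def)
  show "j < r \<Longrightarrow> R j \<in> unit_series" for j
    unfolding R_def ratio_def
    by (intro unit_series_divide unit2 mem) (auto simp: w intro: unit1 unit_series_1 mem)
  show "j < rt \<Longrightarrow> S j \<in> unit_series" for j
    unfolding S_def ratio_t_def
    by (intro unit_series_divide unit2 mem) (auto simp: wt intro: unit1 unit_series_1 mem)
  show "R j = 1 - to_fract (indet (X j)) * R j * R 0 - to_fract (indet (Y j)) * R j * S 0
      + (if Suc j < r then to_fract (indet (Z j)) * R j * R (Suc j) else 0)" if j: "j < r"
  proof -
    have "1 + ?e (X j) + ?e (Y j) \<noteq> 0"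
      using unit2[OF mem(1)[OF j] mem(2)[OF j]] by (rule unit_series_nonzero)
    hence "R j * (1 + ?e (X j) + ?e (Y j)) = 1 + w_ext r ?e j"
      by (simp add: R_def ratio_def)
    moreover have "?e (X j) = to_fract (indet (X j)) * R 0" "?e (Y j) = to_fract (indet (Y j)) * S 0"
      using eq[OF mem(1)[OF j]] eq[OF mem(2)[OF j]] by (simp_all only: eta_factor_ratio R_def S_def)
    moreover have "w_ext r ?e j = (if Suc j < r then to_fract (indet (Z j)) * R j * R (Suc j) else 0)"
      unfolding w[OF j] by (intro if_cong refl) (simp only: eq[OF mem(3)] eta_factor_ratio R_def mult.assoc)
    ultimately show ?thesis by (simp add: algebra_simps)
  qed
  show "S j = 1 - to_fract (indet (Xt j)) * S j * S 0 - to_fract (indet (Yt j)) * S j * R 0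
      + (if Suc j < rt then to_fract (indet (Zt j)) * S j * S (Suc j) else 0)" if j: "j < rt"
  proof -
    have "1 + ?e (Xt j) + ?e (Yt j) \<noteq> 0"
      using unit2[OF mem(4)[OF j] mem(5)[OF j]] by (rule unit_series_nonzero)
    hence "S j * (1 + ?e (Xt j) + ?e (Yt j)) = 1 + wt_ext rt ?e j"
      by (simp add: S_def ratio_t_def)
    moreover have "?e (Xt j) = to_fract (indet (Xt j)) * S 0" "?e (Yt j) = to_fract (indet (Yt j)) * R 0"
      using eq[OF mem(4)[OF j]] eq[OF mem(5)[OF j]] by (simp_all only: eta_factor_ratio R_def S_def)
    moreover have "wt_ext rt ?e j = (if Suc j < rt then to_fract (indet (Zt j)) * S j * S (Suc j) else 0)"
      unfolding wt[OF j] by (intro if_cong refl) (simp only: eq[OF mem(6)] eta_factor_ratio S_def mult.assoc)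
    ultimately show ?thesis by (simp add: algebra_simps)
  qed
qed

lemma fract_monomial_eta:
  fixes eta :: "var \<Rightarrow> (var, 'a :: field_char_0) mps"
  assumes "r \<ge> 1" "rt \<ge> 1" "is_eta r rt eta"
  shows "fract_monomial r rt eta q = fract_monomial r rt indet q
    * (power_vec r (ratio r (\<lambda>u. to_fract (eta u))) (pi_vec r rt q)
     * power_vec rt (ratio_t rt (\<lambda>u. to_fract (eta u))) (pit_vec r rt q))"
proof -
  let ?e = "\<lambda>u. to_fract (eta u)"
  define R S where "R = ratio r ?e" and "S = ratio_t rt ?e"
  obtain n nt where n: "r = Suc n" "rt = Suc nt"
    using assms(1,2) by (metis One_nat_def Suc_le_D)
  have R: "R j \<noteq> 0" if "j < Suc n" for j
    using ratio_unit[OF assms(3), of j] that unit_series_nonzero by (simp add: R_def n)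
  have S: "S j \<noteq> 0" if "j < Suc nt" for j
    using ratio_t_unit[OF assms(3), of j] that unit_series_nonzero by (simp add: S_def n)
  have "fract_monomial r rt eta q
      = (\<Prod>v\<in>vars r rt. (to_fract (indet v) * eta_factor r rt ?e v) powi q v)"
    unfolding fract_monomial_def
    by (intro prod.cong refl) (simp only: is_eta_eq[OF assms(3)])
  also have "\<dots> = fract_monomial r rt indet q * (\<Prod>v\<in>vars r rt. eta_factor r rt ?e v powi q v)"
    by (simp add: fract_monomial_def power_int_mult_distrib prod.distrib)
  \<comment> \<open>All \<open>X i\<close> and \<open>Yt i\<close> carry the factor
    \<open>R 0\<close>, so their exponents add up to \<open>p_{-1}\<close>; likewise
    \<open>Xt i\<close> and \<open>Y i\<close> with \<open>S 0\<close> and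
    \<open>pt_{-1}\<close>.\<close>
  also have "(\<Prod>v\<in>vars r rt. eta_factor r rt ?e v powi q v) =
      R 0 powi p_seq r rt q 0 * (\<Prod>j<n. (R j * R (Suc j)) powi p_seq r rt q (Suc j))
      * (S 0 powi pt_seq r rt q 0 * (\<Prod>j<nt. (S j * S (Suc j)) powi pt_seq r rt q (Suc j)))"
    unfolding prod_vars eta_factor_ratio R_def[symmetric] S_def[symmetric]
    using R[of 0] S[of 0]
    by (simp add: prod_power_int_const p_seq_def pt_seq_def p_ext_def pt_ext_def power_int_add n ac_simps)
  also have "R 0 powi p_seq r rt q 0 * (\<Prod>j<n. (R j * R (Suc j)) powi p_seq r rt q (Suc j))
      = power_vec r R (\<lambda>j. p_seq r rt q j + p_seq r rt q (Suc j))"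
    unfolding n(1) by (rule power_vec_consecutive[symmetric]) (use R in \<open>auto simp: p_seq_def p_ext_def\<close>)
  also have "S 0 powi pt_seq r rt q 0 * (\<Prod>j<nt. (S j * S (Suc j)) powi pt_seq r rt q (Suc j))
      = power_vec rt S (\<lambda>j. pt_seq r rt q j + pt_seq r rt q (Suc j))"
    unfolding n(2) by (rule power_vec_consecutive[symmetric]) (use S in \<open>auto simp: pt_seq_def pt_ext_def\<close>)
  also have "(\<lambda>j. p_seq r rt q j + p_seq r rt q (Suc j)) = pi_vec r rt q"
    by (simp add: p_seq_def pi_vec_def fun_eq_iff)
  also have "(\<lambda>j. pt_seq r rt q j + pt_seq r rt q (Suc j)) = pit_vec r rt q"
    by (simp add: pt_seq_def pit_vec_def fun_eq_iff)
  finally show ?thesis by (simp add: R_def S_def)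
qed

lemma expansion_eq_power_vec:
  fixes eta :: "var \<Rightarrow> (var, 'a :: field_char_0) mps"
  assumes "r \<ge> 1" "rt \<ge> 1" "is_eta r rt eta"
  shows "to_fract (expansion r rt \<mu> \<nu>) = power_vec r (ratio r (\<lambda>u. to_fract (eta u))) \<mu>
    * power_vec rt (ratio_t rt (\<lambda>u. to_fract (eta u))) \<nu>"
proof -
  let ?e = "\<lambda>u. to_fract (eta u)"
  define R S where "R = ratio r ?e" and "S = ratio_t rt ?e"
  have R: "R j \<in> unit_series" if "j < r" for j
    using ratio_unit[OF assms(3)] that by (simp add: R_def)
  have S: "S j \<in> unit_series" if "j < rt" for j
    using ratio_t_unit[OF assms(3)] that by (simp add: S_def)
  note nz = R[THEN unit_series_nonzero] S[THEN unit_series_nonzero]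
  \<comment> \<open>Uniqueness is available for series only, so the power products are lifted from
    the fraction field to a family \<open>C\<close> of series.\<close>
  have "power_vec r R \<mu> * power_vec rt S \<nu> \<in> unit_series" for \<mu> \<nu>
    unfolding power_vec_def
    by (intro unit_series_mult unit_series_prod unit_series_power_int R S) auto
  hence "\<forall>\<mu> \<nu>. \<exists>c. to_fract c = power_vec r R \<mu> * power_vec rt S \<nu>"
    unfolding unit_series_def by (metis (mono_tags, lifting) imageE)
  then obtain C where C: "\<And>\<mu> \<nu>. to_fract (C \<mu> \<nu>) = power_vec r R \<mu> * power_vec rt S \<nu>"
    by metis
  have pos: "0 < r" "0 < rt" using assms by auto
  have rec1: "half_rec r X Y Z C"
    by (rule half_rec_power_vec[OF C nz(1) nz(2)[OF pos(2)] assms(2)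
        ratio_rec[OF assms(3), folded R_def S_def]])
  have C': "to_fract (C \<mu> \<nu>) = power_vec rt S \<nu> * power_vec r R \<mu>" for \<mu> \<nu>
    unfolding C by (rule mult.commute)
  have rec2: "half_rec rt Xt Yt Zt (\<lambda>\<nu> \<mu>. C \<mu> \<nu>)"
    by (rule half_rec_power_vec[OF C' nz(2) nz(1)[OF pos(1)] assms(1)
        ratio_t_rec[OF assms(3), folded R_def S_def]])
  have "expansion r rt \<mu> \<nu> - C \<mu> \<nu> = 0"
  proof (rule half_rec_unique)
    show "half_rec r X Y Z (\<lambda>\<mu> \<nu>. expansion r rt \<mu> \<nu> - C \<mu> \<nu>)"
      by (intro half_rec_diff half_rec_expansion rec1)
    show "half_rec rt Xt Yt Zt (\<lambda>\<nu> \<mu>. expansion r rt \<mu> \<nu> - C \<mu> \<nu>)"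
      by (intro half_rec_diff half_rec_expansion rec2)
    have "to_fract (C 0 0) = 1" by (simp add: C power_vec_def)
    hence "C 0 0 = 1" by (metis to_fract_1 to_fract_eq_iff)
    thus "expansion r rt 0 0 - C 0 0 = 0" using expansion_0[OF assms(1,2)] by simp
  next
    fix \<mu> \<mu>' \<nu> \<nu>' :: "nat \<Rightarrow> int"
    assume eq: "\<And>j. j < r \<Longrightarrow> \<mu> j = \<mu>' j" "\<And>j. j < rt \<Longrightarrow> \<nu> j = \<nu>' j"
    have "to_fract (C \<mu> \<nu>) = to_fract (C \<mu>' \<nu>')"
      unfolding C using eq by (intro arg_cong2[where f = "(*)"] power_vec_cong)
    moreover have "Phi r rt (\<mu> + a) (\<nu> + b) = (Phi r rt (\<mu>' + a) (\<nu>' + b) :: (var, 'a) mps)" for a b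
      unfolding Phi_series_of using eq by (intro arg_cong[where f = "series_of _"] Phi_coeff_cong) auto
    ultimately show "expansion r rt \<mu> \<nu> - C \<mu> \<nu> = expansion r rt \<mu>' \<nu>' - C \<mu>' \<nu>'"
      by (simp add: expansion_def)
  qed
  thus ?thesis using C[of \<mu> \<nu>] by (simp add: R_def S_def)
qed

theorem theorem4p2:
  fixes r rt :: nat
    and eta :: "var \<Rightarrow> (var, 'a :: field_char_0) mps"
    and q' :: "var \<Rightarrow> int"
  assumes "r \<ge> 1" and "rt \<ge> 1"
    and "is_eta r rt eta"
  shows "fract_monomial r rt eta q' =
    fract_monomial r rt indet q' *
      to_fract (
        (\<Sum>i\<in>{-1..int r - 1}. \<Sum>k\<in>{-1..int rt - 1}. chain X Z i * chain Xt Zt k *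
            Phi r rt (\<lambda>j. pi_vec r rt q' j + nu i j) (\<lambda>j. pit_vec r rt q' j + nu k j))
      - (\<Sum>i\<in>{0..int r - 1}. \<Sum>k\<in>{0..int rt - 1}. chain Y Z i * chain Yt Zt k *
            Phi r rt (\<lambda>j. pi_vec r rt q' j + nu i j) (\<lambda>j. pit_vec r rt q' j + nu k j)))"
  \<comment> \<open>\<open>plus_fun_def\<close> turns the sums of exponent vectors in
    \<open>expansion\<close> into the pointwise sums of the statement.\<close>
  unfolding fract_monomial_eta[OF assms] expansion_eq_power_vec[OF assms, symmetric]
    expansion_def plus_fun_def ..

end
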